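(* Let $q\ge 2$ be an integer, let $\mathcal{H}$ be a Hilbert space, and let $A=(A_1,\dots,A_q)\in B(\mathcal{H})^q$ be a $q$-tuple such that $$\Big\|\sum_{k=1}^q A_k^*A_k\Big\|\le 1.$$ Then the unital map $$\Gamma_A: L^\infty(\mathbb{T})\to B(\ell^2(\mathbb{F}_q^+)\otimes\mathcal{H}),\qquad f\mapsto\Gamma_A[f],$$ is (well defined and) contractive and thus is completely positive.
   Context: $\mathbb{T}=\mathbb{R}/2\pi\mathbb{Z}$. For $f\in L^\infty(\mathbb{T})$, $\widehat f(n)=\int_{\mathbb{T}} f(e^{i\theta})e^{-in\theta}\frac{d\theta}{2\pi}$. $\mathbb{F}_q^+$ is the free unital semigroup on generators $s_1,\dots,s_q$ with neutral element $e$ (empty word); $|u|$ is the length of a word $u$. For a $q$-tuple $A=(A_1,\dots,A_q)$ of bounded operators on $\mathcal{H}$ and $w=s_{i_1}\cdots s_{i_n}$, set $[w](A)=A_{i_1}\cdots A_{i_n}\in B(\mathcal{H})$, and $[e](A)=Id$. Define the operator-valued kernel $\Gamma_A[f]:\mathbb{F}_q^+\times\mathbb{F}_q^+\to B(\mathcal{H})$ by $$\Gamma_A[f](u,v)=\begin{cases}\widehat f(|u|-|v|)\,[w](A), & u=wv \text{ for some } w\in\mathbb{F}_q^+,\\ \widehat f(|u|-|v|)\,([w](A))^*, & v=wu\text{ for some } w\in\mathbb{F}_q^+,\\ 0,&\text{otherwise.}\end{cases}$$ A $B(\mathcal{H})$-valued kernel $K$ on $\mathbb{F}_q^+$ is identified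 with the bounded operator $\mathbf{K}$ on $\ell^2(\mathbb{F}_q^+)\otimes\mathcal{H}$ (if it exists) such that $\langle \mathbf{K}(\delta_v\otimes h),\delta_u\otimes h'\rangle=\langle K(u,v)h,h'\rangle$ for all $u,v\in\mathbb{F}_q^+$, $h,h'\in\mathcal{H}$. *)

theory Defs
  imports "HOL-Probability.Probability"
begin

section \<open>Complex Hilbert spaces\<close>

text \<open>Complex inner products sit on top of the library's real ones, so that norm, topology,
  bounded linear maps, the operator norm \<^const>\<open>onorm\<close> and completeness are those of the library.
  The inner product is linear in its first and conjugate-linear in its second argument.\<close>

class complex_inner = real_inner +
  fixes scaleC :: "complex \<Rightarrow> 'a \<Rightarrow> 'a" (infixr \<open>*\<^sub>C\<close> 75)
    and cinner :: "'a \<Rightarrow> 'a \<Rightarrow> complex"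
  assumes scaleC_add_right: "c *\<^sub>C (x + y) = c *\<^sub>C x + c *\<^sub>C y"
    and scaleC_add_left: "(c + d) *\<^sub>C x = c *\<^sub>C x + d *\<^sub>C x"
    and scaleC_scaleC: "c *\<^sub>C d *\<^sub>C x = (c * d) *\<^sub>C x"
    and scaleC_of_real: "of_real r *\<^sub>C x = r *\<^sub>R x"
    and cinner_commute: "cinner x y = cnj (cinner y x)"
    and cinner_add_left: "cinner (x + y) z = cinner x z + cinner y z"
    and cinner_scaleC_left: "cinner (c *\<^sub>C x) y = c * cinner x y"
    and inner_eq_Re_cinner: "inner x y = Re (cinner x y)"

class chilbert_space = complex_inner + banach

instantiation complex :: chilbert_space
begin

definition scaleC_complex_def: "scaleC = ((*) :: complex \<Rightarrow> complex \<Rightarrow> complex)"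
definition cinner_complex_def: "cinner x y = x * cnj y"

instance
  by standard
    (auto simp: scaleC_complex_def cinner_complex_def inner_complex_def algebra_simps scaleR_conv_of_real)

end

lemma cinner_add_right: "cinner x (y + z) = cinner x y + cinner x z"
  by (metis cinner_add_left cinner_commute complex_cnj_add)

lemma cinner_scaleC_right: "cinner x (c *\<^sub>C y) = cnj c * cinner x y"
  by (metis cinner_commute cinner_scaleC_left complex_cnj_mult)

lemma scaleC_zero_left [simp]: "0 *\<^sub>C x = (0 :: 'a :: complex_inner)"
  using scaleC_add_left[of 0 0 x] by simp

lemma scaleC_zero_right [simp]: "c *\<^sub>C 0 = (0 :: 'a :: complex_inner)"
  using scaleC_add_right[of c 0 0] by simp

lemma scaleC_one [simp]: "1 *\<^sub>C x = (x :: 'a :: complex_inner)"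
  using scaleC_of_real[of 1 x] by simp

lemma cinner_zero_left [simp]: "cinner 0 x = 0"
  using cinner_add_left[of 0 0 x] by simp

lemma cinner_zero_right [simp]: "cinner x 0 = 0"
  using cinner_add_right[of x 0 0] by simp

lemma cinner_self: "cinner x x = of_real ((norm x)\<^sup>2)"
proof (rule complex_eqI)
  show "Re (cinner x x) = Re (of_real ((norm x)\<^sup>2))"
    by (simp add: power2_norm_eq_inner inner_eq_Re_cinner)
  have "Im (cinner x x) = - Im (cinner x x)"
    by (metis cinner_commute complex_cnj_cnj cnj.simps(2))
  then show "Im (cinner x x) = Im (of_real ((norm x)\<^sup>2))" by simp
qed

lemma norm_scaleC: "norm (c *\<^sub>C x) = cmod c * norm (x :: 'a :: complex_inner)"
proof -
  have "of_real ((norm (c *\<^sub>C x))\<^sup>2) = c * cnj c * of_real ((norm x)\<^sup>2)"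
    by (simp only: cinner_self[symmetric] cinner_scaleC_left cinner_scaleC_right mult_ac)
  also have "\<dots> = of_real ((cmod c * norm x)\<^sup>2)"
    by (simp add: complex_norm_square[symmetric] power_mult_distrib)
  finally have "(norm (c *\<^sub>C x))\<^sup>2 = (cmod c * norm x)\<^sup>2" by (simp only: of_real_eq_iff)
  then show ?thesis by simp
qed

lemma cinner_Cauchy_Schwarz: "cmod (cinner x y) \<le> norm x * norm y"
proof (cases "cinner x y = 0")
  case False
  define c where "c = cnj (cinner x y) / of_real (cmod (cinner x y))"
  have c1: "cmod c = 1" using False by (simp add: c_def norm_divide)
  have "c * cinner x y = of_real (cmod (cinner x y))"
    using False complex_norm_square[of "cinner x y"]
    by (simp add: c_def field_simps power2_eq_square)
  then have "cmod (cinner x y) = inner (c *\<^sub>C x) y"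
    by (simp add: inner_eq_Re_cinner cinner_scaleC_left)
  also have "\<dots> \<le> norm (c *\<^sub>C x) * norm y" by (rule norm_cauchy_schwarz)
  finally show ?thesis by (simp add: norm_scaleC c1)
qed simp

definition bounded_clinear :: "('a::complex_inner \<Rightarrow> 'b::complex_inner) \<Rightarrow> bool" where
  "bounded_clinear f \<longleftrightarrow> bounded_linear f \<and> (\<forall>c x. f (c *\<^sub>C x) = c *\<^sub>C f x)"

definition cadjoint :: "('a::chilbert_space \<Rightarrow> 'a) \<Rightarrow> 'a \<Rightarrow> 'a" where
  "cadjoint S = (THE S'. bounded_clinear S' \<and> (\<forall>x y. cinner (S x) y = cinner x (S' y)))"


section \<open>The Hilbert tensor product of \<open>\<ell>\<^sup>2(I)\<close> with a Hilbert space\<close>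

text \<open>\<open>\<ell>\<^sup>2(I) \<otimes> H\<close> is realised as the space of square-summable families \<open>I \<Rightarrow> H\<close>, where
  \<open>a \<otimes> h\<close> is the family \<open>(a\<^sub>i h)\<^sub>i\<close>; \<open>\<ell>\<^sup>2(I)\<close> itself is the case \<open>H = \<complex>\<close>. The
  lemmas \<open>cinner_tensor\<close> and \<open>closure_span_tensor\<close> below are the characteristic
  properties of the Hilbert tensor product.\<close>

typedef (overloaded) ('i, 'h::complex_inner) ell2 =
  "{x :: 'i \<Rightarrow> 'h. (\<lambda>i. (norm (x i))\<^sup>2) summable_on UNIV}"
  morphisms coord Abs_ell2
  by (rule exI[of _ "\<lambda>_. 0"]) simp

setup_lifting type_definition_ell2

lemma coord_summable: "(\<lambda>i. (norm (coord x i))\<^sup>2) summable_on UNIV"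
  using coord[of x] by simp

lemma ell2_eqI: "(\<And>i. coord x i = coord y i) \<Longrightarrow> x = y"
  by (simp add: coord_inject[symmetric] fun_eq_iff)

lemma norm_add_sq_le: "(norm (x + y))\<^sup>2 \<le> 2 * (norm x)\<^sup>2 + 2 * (norm (y::'a::real_normed_vector))\<^sup>2"
proof -
  have "(norm (x + y))\<^sup>2 \<le> (norm x + norm y)\<^sup>2"
    by (simp add: norm_triangle_ineq power_mono)
  also have "\<dots> \<le> 2 * (norm x)\<^sup>2 + 2 * (norm y)\<^sup>2"
    using zero_le_power2[of "norm x - norm y"] by (simp add: power2_eq_square algebra_simps)
  finally show ?thesis .
qed

lemma sq_summable_add:
  fixes x y :: "'i \<Rightarrow> 'h::real_normed_vector"
  assumes "(\<lambda>i. (norm (x i))\<^sup>2) summable_on UNIV" "(\<lambda>i. (norm (y i))\<^sup>2) summable_on UNIV"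
  shows "(\<lambda>i. (norm (x i + y i))\<^sup>2) summable_on UNIV"
proof (rule summable_on_comparison_test)
  show "(\<lambda>i. 2 * (norm (x i))\<^sup>2 + 2 * (norm (y i))\<^sup>2) summable_on UNIV"
    by (intro summable_on_add summable_on_cmult_right assms)
qed (auto intro: norm_add_sq_le)

instantiation ell2 :: (type, complex_inner) ab_group_add
begin

lift_definition zero_ell2 :: "('a, 'b) ell2" is "\<lambda>_. 0" by simp
lift_definition plus_ell2 :: "('a, 'b) ell2 \<Rightarrow> ('a, 'b) ell2 \<Rightarrow> ('a, 'b) ell2"
  is "\<lambda>x y i. x i + y i" by (rule sq_summable_add)
lift_definition uminus_ell2 :: "('a, 'b) ell2 \<Rightarrow> ('a, 'b) ell2" is "\<lambda>x i. - x i" by simp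
lift_definition minus_ell2 :: "('a, 'b) ell2 \<Rightarrow> ('a, 'b) ell2 \<Rightarrow> ('a, 'b) ell2"
  is "\<lambda>x y i. x i - y i"
  subgoal for x y using sq_summable_add[of x "\<lambda>i. - y i"] by simp
  done

instance
  by standard (transfer; simp add: algebra_simps fun_eq_iff)+

end

lemma coord_zero [simp]: "coord 0 i = 0" by (simp add: zero_ell2.rep_eq)
lemma coord_add: "coord (x + y) i = coord x i + coord y i" by (simp add: plus_ell2.rep_eq)
lemma coord_minus: "coord (x - y) i = coord x i - coord y i" by (simp add: minus_ell2.rep_eq)

lemma cinner_coord_summable: "(\<lambda>i. cinner (coord x i) (coord y i)) summable_on UNIV"
proof (rule abs_summable_summable, rule summable_on_comparison_test)
  show "(\<lambda>i. (norm (coord x i))\<^sup>2 + (norm (coord y i))\<^sup>2) summable_on UNIV"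
    by (intro summable_on_add coord_summable)
  fix i
  have "cmod (cinner (coord x i) (coord y i)) \<le> norm (coord x i) * norm (coord y i)"
    by (rule cinner_Cauchy_Schwarz)
  also have "\<dots> \<le> (norm (coord x i))\<^sup>2 + (norm (coord y i))\<^sup>2"
    using zero_le_power2[of "norm (coord x i) - norm (coord y i)"]
      mult_nonneg_nonneg[OF norm_ge_zero[of "coord x i"] norm_ge_zero[of "coord y i"]]
    by (simp only: power2_eq_square algebra_simps)
  finally show "norm (cinner (coord x i) (coord y i)) \<le> (norm (coord x i))\<^sup>2 + (norm (coord y i))\<^sup>2" .
qed simp

instantiation ell2 :: (type, complex_inner) real_vector
begin

lift_definition scaleR_ell2 :: "real \<Rightarrow> ('a, 'b) ell2 \<Rightarrow> ('a, 'b) ell2" is "\<lambda>c x i. c *\<^sub>R x i"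
  by (simp add: power_mult_distrib summable_on_cmult_right)

instance
  by standard (transfer; simp add: algebra_simps)+

end

instantiation ell2 :: (type, complex_inner) complex_inner
begin

lift_definition scaleC_ell2 :: "complex \<Rightarrow> ('a, 'b) ell2 \<Rightarrow> ('a, 'b) ell2" is "\<lambda>c x i. c *\<^sub>C x i"
  by (simp add: norm_scaleC power_mult_distrib summable_on_cmult_right)
definition cinner_ell2 :: "('a, 'b) ell2 \<Rightarrow> ('a, 'b) ell2 \<Rightarrow> complex" where
  "cinner_ell2 x y = (\<Sum>\<^sub>\<infinity>i. cinner (coord x i) (coord y i))"
definition inner_ell2 :: "('a, 'b) ell2 \<Rightarrow> ('a, 'b) ell2 \<Rightarrow> real" where
  "inner_ell2 x y = Re (cinner x y)"
definition norm_ell2 :: "('a, 'b) ell2 \<Rightarrow> real" where "norm_ell2 x = sqrt (inner x x)"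
definition dist_ell2 :: "('a, 'b) ell2 \<Rightarrow> ('a, 'b) ell2 \<Rightarrow> real" where "dist_ell2 x y = norm (x - y)"
definition sgn_ell2 :: "('a, 'b) ell2 \<Rightarrow> ('a, 'b) ell2" where "sgn_ell2 x = x /\<^sub>R norm x"
definition uniformity_ell2 :: "(('a, 'b) ell2 \<times> ('a, 'b) ell2) filter" where
  "uniformity_ell2 = (INF e\<in>{0<..}. principal {(x, y). dist x y < e})"
definition open_ell2 :: "('a, 'b) ell2 set \<Rightarrow> bool" where
  "open_ell2 U = (\<forall>x\<in>U. \<forall>\<^sub>F (x', y) in uniformity. x' = x \<longrightarrow> y \<in> U)"

instance
proof
  fix x y z :: "('a, 'b) ell2" and c d :: complex and r s :: real and U :: "('a, 'b) ell2 set"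
  show "uniformity = (INF e\<in>{0<..}. principal {(x, y::('a, 'b) ell2). dist x y < e})"
    by (rule uniformity_ell2_def)
  show "open U = (\<forall>x\<in>U. \<forall>\<^sub>F (x', y) in uniformity. x' = x \<longrightarrow> y \<in> U)"
    by (rule open_ell2_def)
  show "dist x y = norm (x - y)" by (rule dist_ell2_def)
  show "sgn x = x /\<^sub>R norm x" by (rule sgn_ell2_def)
  show "norm x = sqrt (inner x x)" by (rule norm_ell2_def)
  show "inner x y = Re (cinner x y)" by (rule inner_ell2_def)
  show "c *\<^sub>C (x + y) = c *\<^sub>C x + c *\<^sub>C y" by transfer (simp add: scaleC_add_right)
  show "(c + d) *\<^sub>C x = c *\<^sub>C x + d *\<^sub>C x" by transfer (simp add: scaleC_add_left)
  show "c *\<^sub>C d *\<^sub>C x = (c * d) *\<^sub>C x" by transfer (simp add: scaleC_scaleC)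
  show sR: "of_real r *\<^sub>C x = r *\<^sub>R x" for r and x :: "('a, 'b) ell2"
    by transfer (simp add: scaleC_of_real)
  show cc: "cinner x y = cnj (cinner y x)"
    unfolding cinner_ell2_def infsum_cnj[symmetric] by (metis cinner_commute)
  show ca: "cinner (x + y) z = cinner x z + cinner y z"
    unfolding cinner_ell2_def
    by (simp add: coord_add cinner_add_left infsum_add cinner_coord_summable)
  show cs: "cinner (c *\<^sub>C x) y = c * cinner x y" for c
    unfolding cinner_ell2_def
    by (simp add: scaleC_ell2.rep_eq cinner_scaleC_left infsum_cmult_right cinner_coord_summable)
  show "inner x y = inner y x" by (simp add: inner_ell2_def cc)
  show "inner (x + y) z = inner x z + inner y z" by (simp add: inner_ell2_def ca)
  show "inner (r *\<^sub>R x) y = r * inner x y" by (simp add: inner_ell2_def sR[symmetric] cs)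
  have ii: "inner x x = (\<Sum>\<^sub>\<infinity>i. (norm (coord x i))\<^sup>2)"
    using infsum_Re[OF cinner_coord_summable[of x x]]
    by (simp add: inner_ell2_def cinner_ell2_def cinner_self)
  show "0 \<le> inner x x" unfolding ii by (rule infsum_nonneg) simp
  show "inner x x = 0 \<longleftrightarrow> x = 0"
  proof
    assume 0: "inner x x = 0"
    show "x = 0"
    proof (rule ell2_eqI)
      fix i
      have "(norm (coord x i))\<^sup>2 = 0"
        by (rule nonneg_infsum_le_0D[of _ UNIV]) (use 0 ii coord_summable in auto)
      then show "coord x i = coord 0 i" by simp
    qed
  next
    assume "x = 0"
    then show "inner x x = 0" unfolding ii by simp
  qed
qed

end

lemma norm_ell2_sq: "(norm x)\<^sup>2 = (\<Sum>\<^sub>\<infinity>i. (norm (coord x i))\<^sup>2)"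
  using infsum_Re[OF cinner_coord_summable[of x x]]
  by (simp add: power2_norm_eq_inner inner_ell2_def cinner_ell2_def cinner_self)

lemma sum_coord_le: "finite F \<Longrightarrow> (\<Sum>i\<in>F. (norm (coord x i))\<^sup>2) \<le> (norm x)\<^sup>2"
  unfolding norm_ell2_sq by (rule finite_sum_le_infsum) (auto simp: coord_summable)

lemma norm_coord_le: "norm (coord x i) \<le> norm x"
  using sum_coord_le[of "{i}" x] by simp

instance ell2 :: (type, chilbert_space) chilbert_space
proof
  fix X :: "nat \<Rightarrow> ('a, 'b) ell2"
  assume X: "Cauchy X"
  have "Cauchy (\<lambda>n. coord (X n) i)" for i
  proof (rule metric_CauchyI)
    fix e :: real assume "0 < e"
    then obtain N where "\<forall>m\<ge>N. \<forall>n\<ge>N. dist (X m) (X n) < e" using X metric_CauchyD by blast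
    then show "\<exists>N. \<forall>m\<ge>N. \<forall>n\<ge>N. dist (coord (X m) i) (coord (X n) i) < e"
      by (intro exI[of _ N])
        (auto simp: dist_norm coord_minus[symmetric] intro: le_less_trans[OF norm_coord_le])
  qed
  then have "\<forall>i. \<exists>l. (\<lambda>n. coord (X n) i) \<longlonglongrightarrow> l"
    by (simp add: Cauchy_convergent_iff convergent_def)
  then obtain L where L: "\<And>i. (\<lambda>n. coord (X n) i) \<longlonglongrightarrow> L i" by metis
  have bd: "\<exists>N. \<forall>n\<ge>N. \<forall>F. finite F \<longrightarrow> (\<Sum>i\<in>F. (norm (coord (X n) i - L i))\<^sup>2) \<le> e\<^sup>2"
    if "0 < e" for e
  proof -
    obtain N where N: "\<And>m n. m \<ge> N \<Longrightarrow> n \<ge> N \<Longrightarrow> dist (X m) (X n) < e"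
      using metric_CauchyD[OF X \<open>0 < e\<close>] by blast
    show ?thesis
    proof (intro exI[of _ N] allI impI)
      fix n F assume n: "N \<le> n" and F: "finite (F :: 'a set)"
      show "(\<Sum>i\<in>F. (norm (coord (X n) i - L i))\<^sup>2) \<le> e\<^sup>2"
      proof (rule Lim_bounded)
        show "(\<lambda>m. \<Sum>i\<in>F. (norm (coord (X n) i - coord (X m) i))\<^sup>2)
                \<longlonglongrightarrow> (\<Sum>i\<in>F. (norm (coord (X n) i - L i))\<^sup>2)"
          by (intro tendsto_intros L)
        show "\<forall>m\<ge>N. (\<Sum>i\<in>F. (norm (coord (X n) i - coord (X m) i))\<^sup>2) \<le> e\<^sup>2"
        proof (intro allI impI)
          fix m assume m: "N \<le> m"
          have "(\<Sum>i\<in>F. (norm (coord (X n - X m) i))\<^sup>2) \<le> (norm (X n - X m))\<^sup>2"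
            by (rule sum_coord_le[OF F])
          also have "\<dots> \<le> e\<^sup>2"
            using N[OF n m] by (intro power_mono) (auto simp: dist_norm)
          finally show "(\<Sum>i\<in>F. (norm (coord (X n) i - coord (X m) i))\<^sup>2) \<le> e\<^sup>2"
            by (simp add: coord_minus)
        qed
      qed
    qed
  qed
  have summ: "(\<lambda>i. (norm (coord (X n) i - L i))\<^sup>2) summable_on UNIV"
    if "\<forall>F. finite F \<longrightarrow> (\<Sum>i\<in>F. (norm (coord (X n) i - L i))\<^sup>2) \<le> e\<^sup>2" for n e
    by (rule nonneg_bounded_partial_sums_imp_summable_on[of _ _ "e\<^sup>2"])
      (use that in \<open>auto intro!: eventually_finite_subsets_at_top_weakI\<close>)
  obtain N1 where N1: "\<forall>F. finite F \<longrightarrow> (\<Sum>i\<in>F. (norm (coord (X N1) i - L i))\<^sup>2) \<le> 1\<^sup>2"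
    using bd[of 1] by auto
  have "(\<lambda>i. (norm (coord (X N1) i + - (coord (X N1) i - L i)))\<^sup>2) summable_on UNIV"
    by (rule sq_summable_add) (use summ[OF N1] coord_summable in \<open>auto simp: norm_minus_commute\<close>)
  then have "(\<lambda>i. (norm (L i))\<^sup>2) summable_on UNIV" by simp
  then have cL: "coord (Abs_ell2 L) = L" by (simp add: Abs_ell2_inverse)
  have "X \<longlonglongrightarrow> Abs_ell2 L"
  proof (rule metric_LIMSEQ_I)
    fix e :: real assume e: "0 < e"
    obtain N where N: "\<And>n F. n \<ge> N \<Longrightarrow> finite F \<Longrightarrow>
        (\<Sum>i\<in>F. (norm (coord (X n) i - L i))\<^sup>2) \<le> (e/2)\<^sup>2"
      using bd[of "e/2"] e by auto
    show "\<exists>N. \<forall>n\<ge>N. dist (X n) (Abs_ell2 L) < e"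
    proof (intro exI[of _ N] allI impI)
      fix n assume n: "N \<le> n"
      have "(norm (X n - Abs_ell2 L))\<^sup>2 \<le> (e/2)\<^sup>2"
        unfolding norm_ell2_sq
        by (rule infsum_le_finite_sums) (auto simp: coord_minus cL summ[of n "e/2"] N[OF n])
      then have "norm (X n - Abs_ell2 L) \<le> e/2"
        using e by (auto intro: power2_le_imp_le)
      then show "dist (X n) (Abs_ell2 L) < e" using e by (simp add: dist_norm)
    qed
  qed
  then show "convergent X" by (auto simp: convergent_def)
qed

lift_definition tensor :: "('i, complex) ell2 \<Rightarrow> 'h::complex_inner \<Rightarrow> ('i, 'h) ell2" (infixr \<open>\<otimes>\<^sub>h\<close> 70)
  is "\<lambda>a h i. a i *\<^sub>C h"
  by (simp add: norm_scaleC power_mult_distrib summable_on_cmult_left)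

lift_definition delta :: "'i \<Rightarrow> ('i, complex) ell2" is "\<lambda>v i. if i = v then 1 else 0"
  subgoal for v by (rule finite_nonzero_values_imp_summable_on, rule finite_subset[of _ "{v}"]) auto
  done

lemma cinner_tensor: "cinner (a \<otimes>\<^sub>h h) (b \<otimes>\<^sub>h h') = cinner a b * cinner h h'"
proof -
  have "cinner (a \<otimes>\<^sub>h h) (b \<otimes>\<^sub>h h') = (\<Sum>\<^sub>\<infinity>i. cinner (coord a i) (coord b i) * cinner h h')"
    by (simp add: cinner_ell2_def tensor.rep_eq cinner_scaleC_left cinner_scaleC_right
        cinner_complex_def mult_ac)
  also have "\<dots> = cinner a b * cinner h h'"
    by (simp add: cinner_ell2_def infsum_cmult_left cinner_coord_summable)
  finally show ?thesis .
qed

lemma coord_sum: "coord (sum f F) i = (\<Sum>j\<in>F. coord (f j) i)"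
  by (induction F rule: infinite_finite_induct) (auto simp: coord_add)

lemma coord_delta_tensor: "coord (delta v \<otimes>\<^sub>h h) i = (if i = v then h else 0)"
  by (simp add: tensor.rep_eq delta.rep_eq)

lemma closure_span_tensor:
  "closure (span (range (\<lambda>(v, h). delta v \<otimes>\<^sub>h h))) = (UNIV :: ('i, 'h::complex_inner) ell2 set)"
proof (intro equalityI subset_UNIV subsetI)
  fix x :: "('i, 'h) ell2"
  show "x \<in> closure (span (range (\<lambda>(v, h). delta v \<otimes>\<^sub>h h)))"
    unfolding closure_approachable
  proof (intro allI impI)
    fix e :: real assume e: "0 < e"
    obtain F where F: "finite F"
      and d: "dist (\<Sum>i\<in>F. (norm (coord x i))\<^sup>2) (\<Sum>\<^sub>\<infinity>i. (norm (coord x i))\<^sup>2) \<le> (e/2)\<^sup>2"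
      using infsum_finite_approximation[OF coord_summable[of x], of "(e/2)\<^sup>2"] e by auto
    define y where "y = (\<Sum>v\<in>F. delta v \<otimes>\<^sub>h coord x v)"
    have cy: "coord y i = (if i \<in> F then coord x i else 0)" for i
      using F by (simp add: y_def coord_sum coord_delta_tensor)
    have yx: "(norm (coord (y - x) i))\<^sup>2 = (if i \<in> F then 0 else (norm (coord x i))\<^sup>2)" for i
      by (simp add: coord_minus cy)
    have "(norm (y - x))\<^sup>2 = (\<Sum>\<^sub>\<infinity>i\<in>-F. (norm (coord x i))\<^sup>2)"
      unfolding norm_ell2_sq yx by (rule infsum_cong_neutral) auto
    also have "\<dots> = (\<Sum>\<^sub>\<infinity>i. (norm (coord x i))\<^sup>2) - (\<Sum>i\<in>F. (norm (coord x i))\<^sup>2)"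
    proof -
      have "(\<Sum>\<^sub>\<infinity>i\<in>F \<union> -F. (norm (coord x i))\<^sup>2)
          = (\<Sum>\<^sub>\<infinity>i\<in>F. (norm (coord x i))\<^sup>2) + (\<Sum>\<^sub>\<infinity>i\<in>-F. (norm (coord x i))\<^sup>2)"
        by (rule infsum_Un_disjoint)
          (auto simp: F intro: summable_on_subset[OF coord_summable])
      then show ?thesis using F by simp
    qed
    also have "\<dots> \<le> (e/2)\<^sup>2" using d by (simp add: dist_real_def)
    finally have "norm (y - x) \<le> e/2" using e by (auto intro: power2_le_imp_le)
    moreover have "y \<in> span (range (\<lambda>(v, h). delta v \<otimes>\<^sub>h h))"
      unfolding y_def by (intro span_sum span_base) auto
    ultimately show "\<exists>y\<in>span (range (\<lambda>(v, h). delta v \<otimes>\<^sub>h h)). dist y x < e"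
      using e by (intro bexI[of _ y]) (auto simp: dist_norm)
  qed
qed


section \<open>Bounded measurable functions on the circle\<close>

text \<open>\<open>\<real>/2\<pi>\<int>\<close> is identified with the unit circle via \<open>\<theta> \<mapsto> e\<^sup>i\<^sup>\<theta>\<close>, and
  elements of \<open>L\<^sup>\<infinity>\<close> are represented by functions, almost everywhere equal functions
  representing the same element.\<close>

abbreviation angle :: "real measure" where
  "angle \<equiv> uniform_measure lborel {0..2 * pi}"

definition circle :: "complex measure" where
  "circle = distr angle (restrict_space borel (sphere 0 1)) cis"

definition fourier_coeff :: "(complex \<Rightarrow> complex) \<Rightarrow> int \<Rightarrow> complex" where
  "fourier_coeff f n = (LINT \<theta>|angle. f (cis \<theta>) * cis (- (of_int n * \<theta>)))"

definition Linf :: "'a measure \<Rightarrow> ('a \<Rightarrow> complex) set" where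
  "Linf M = {f \<in> borel_measurable M. esssup M (\<lambda>z. ereal (cmod (f z))) < \<infinity>}"

definition Linf_norm :: "'a measure \<Rightarrow> ('a \<Rightarrow> complex) \<Rightarrow> real" where
  "Linf_norm M f = real_of_ereal (esssup M (\<lambda>z. ereal (cmod (f z))))"


section \<open>Contractive and completely positive maps from \<open>L\<^sup>\<infinity>\<close> to \<open>B(K)\<close>\<close>

definition Linf_operator_map ::
  "'a measure \<Rightarrow> (('a \<Rightarrow> complex) \<Rightarrow> 'k::chilbert_space \<Rightarrow> 'k) \<Rightarrow> bool" where
  "Linf_operator_map M \<Phi> \<longleftrightarrow>
     (\<forall>f\<in>Linf M. bounded_clinear (\<Phi> f)) \<and>
     (\<forall>f\<in>Linf M. \<forall>g\<in>Linf M. (AE z in M. f z = g z) \<longrightarrow> \<Phi> f = \<Phi> g) \<and>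
     (\<forall>f\<in>Linf M. \<forall>g\<in>Linf M. \<Phi> (\<lambda>z. f z + g z) = (\<lambda>x. \<Phi> f x + \<Phi> g x)) \<and>
     (\<forall>c. \<forall>f\<in>Linf M. \<Phi> (\<lambda>z. c * f z) = (\<lambda>x. c *\<^sub>C \<Phi> f x))"

definition contractive ::
  "'a measure \<Rightarrow> (('a \<Rightarrow> complex) \<Rightarrow> 'k::chilbert_space \<Rightarrow> 'k) \<Rightarrow> bool" where
  "contractive M \<Phi> \<longleftrightarrow>
     Linf_operator_map M \<Phi> \<and> (\<forall>f\<in>Linf M. onorm (\<Phi> f) \<le> Linf_norm M f)"

text \<open>Positivity in \<open>M\<^sub>n(B(K)) = B(K\<^sup>n)\<close>; the order on \<^typ>\<open>complex\<close> makes \<open>0 \<le> z\<close>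
  say that \<open>z\<close> is real and nonnegative.\<close>

definition positive_op_matrix :: "nat \<Rightarrow> (nat \<Rightarrow> nat \<Rightarrow> 'k::chilbert_space \<Rightarrow> 'k) \<Rightarrow> bool" where
  "positive_op_matrix n T \<longleftrightarrow> (\<forall>x. 0 \<le> (\<Sum>i<n. \<Sum>j<n. cinner (T i j (x j)) (x i)))"

text \<open>An element of \<open>M\<^sub>n(L\<^sup>\<infinity>(M)) = L\<^sup>\<infinity>(M; M\<^sub>n(\<complex>))\<close> is positive iff almost all of its values
  are, a scalar being identified with the operator of multiplication by it on \<open>\<complex>\<close>.\<close>

definition positive_Linf_matrix :: "'a measure \<Rightarrow> nat \<Rightarrow> (nat \<Rightarrow> nat \<Rightarrow> 'a \<Rightarrow> complex) \<Rightarrow> bool" where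
  "positive_Linf_matrix M n F \<longleftrightarrow>
     (\<forall>i<n. \<forall>j<n. F i j \<in> Linf M) \<and> (AE z in M. positive_op_matrix n (\<lambda>i j w. F i j z * w))"

definition completely_positive ::
  "'a measure \<Rightarrow> (('a \<Rightarrow> complex) \<Rightarrow> 'k::chilbert_space \<Rightarrow> 'k) \<Rightarrow> bool" where
  "completely_positive M \<Phi> \<longleftrightarrow>
     Linf_operator_map M \<Phi> \<and>
     (\<forall>n F. positive_Linf_matrix M n F \<longrightarrow> positive_op_matrix n (\<lambda>i j. \<Phi> (F i j)))"


section \<open>The kernel and the operator\<close>

text \<open>The free semigroup on \<open>q\<close> generators is the type \<^typ>\<open>'q list\<close> with \<open>CARD('q) = q\<close>.\<close>

primrec word_op :: "('q \<Rightarrow> 'h \<Rightarrow> 'h) \<Rightarrow> 'q list \<Rightarrow> 'h \<Rightarrow> 'h" where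
  "word_op A [] = id"
| "word_op A (k # w) = A k \<circ> word_op A w"

definition Gamma_kernel ::
  "('q \<Rightarrow> 'h::chilbert_space \<Rightarrow> 'h) \<Rightarrow> (complex \<Rightarrow> complex) \<Rightarrow> 'q list \<Rightarrow> 'q list \<Rightarrow> 'h \<Rightarrow> 'h" where
  "Gamma_kernel A f u v =
     (let c = fourier_coeff f (int (length u) - int (length v)) in
      if \<exists>w. u = w @ v then (\<lambda>h. c *\<^sub>C word_op A (THE w. u = w @ v) h)
      else if \<exists>w. v = w @ u then (\<lambda>h. c *\<^sub>C cadjoint (word_op A (THE w. v = w @ u)) h)
      else (\<lambda>h. 0))"

definition kernel_operator ::
  "('i \<Rightarrow> 'i \<Rightarrow> 'h::chilbert_space \<Rightarrow> 'h) \<Rightarrow> (('i, 'h) ell2 \<Rightarrow> ('i, 'h) ell2) \<Rightarrow> bool" where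
  "kernel_operator K T \<longleftrightarrow> bounded_clinear T \<and>
     (\<forall>u v h h'. cinner (T (delta v \<otimes>\<^sub>h h)) (delta u \<otimes>\<^sub>h h') = cinner (K u v h) h')"

definition Gamma_map ::
  "('q \<Rightarrow> 'h::chilbert_space \<Rightarrow> 'h) \<Rightarrow> (complex \<Rightarrow> complex) \<Rightarrow> ('q list, 'h) ell2 \<Rightarrow> ('q list, 'h) ell2" where
  "Gamma_map A f = (THE T. kernel_operator (Gamma_kernel A f) T)"

end

theory Submission
  imports Defs
begin

text \<open>The operator \<open>T = \<Sum>\<^sub>k L\<^sub>k \<otimes> A\<^sub>k\<close>, where \<open>L\<^sub>k\<close> prepends the letter \<open>k\<close>, is a contraction
  because the \<open>L\<^sub>k\<close> are isometries with orthogonal ranges and \<open>\<Sum>\<^sub>k A\<^sub>k\<^sup>* A\<^sub>k \<le> 1\<close>. Formally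
  \<open>\<Gamma>\<^sub>A[f] = \<Sum>\<^sub>n\<^sub>\<ge>\<^sub>0 f\<^sup>(n) T\<^sup>n + \<Sum>\<^sub>n\<^sub>>\<^sub>0 f\<^sup>(-n) T\<^sup>*\<^sup>n\<close>, writing \<open>f\<^sup>(n)\<close> for the Fourier coefficients of
  \<open>f\<close>. The series need not converge, but \<open>T\<close> raises the length of words by one, so that between
  finitely supported vectors only finitely many terms count. This makes a direct argument possible,
  without dilations and without radial limits.

  Let \<open>P(x, y)\<close> be the form on finitely supported vectors that is obtained when all Fourier
  coefficients are replaced by 1, formally the form of \<open>Re ((1 + T) (1 - T)\<^sup>-\<^sup>1)\<close>. Inserting
  \<open>x = (1 - T) y\<close> turns \<open>P(x, x)\<close> into \<open>\<parallel>y\<parallel>\<^sup>2 - \<parallel>T y\<parallel>\<^sup>2\<close>. The vector \<open>y\<close> has infinite support, but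
  cutting both norms off at words of length at most \<open>N\<close> is harmless: a word of length \<open>N\<close> in \<open>T y\<close>
  comes from a word of length \<open>N - 1\<close> in \<open>y\<close>. Hence \<open>P\<close> is positive (\<open>toeplitz_nonneg\<close>).

  Rotating the component at the word \<open>u\<close> by \<open>e\<^sup>i\<^sup>\<theta>\<^sup>|\<^sup>u\<^sup>|\<close> gives positive forms \<open>P\<^sub>\<theta>\<close>, and since
  \<open>\<Gamma>\<^sub>A[f](u, v)\<close> carries the coefficient of index \<open>|u| - |v|\<close>,
  \<open>\<langle>\<Gamma>\<^sub>A[f] x, y\<rangle> = \<integral> f(e\<^sup>i\<^sup>\<theta>) P\<^sub>\<theta>(x, y) d\<theta>/2\<pi>\<close> (\<open>Gamma_form_integral\<close>). Both claims are
  consequences of this formula.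

  For contractivity, \<open>2 |P\<^sub>\<theta>(x, y)| \<le> P\<^sub>\<theta>(x, x) + P\<^sub>\<theta>(y, y)\<close>, and the mean of \<open>P\<^sub>\<theta>(x, x)\<close> over
  \<open>\<theta>\<close> is \<open>\<parallel>x\<parallel>\<^sup>2\<close>. So the kernel is bounded by \<open>\<parallel>f\<parallel>\<^sub>\<infinity>\<close> on finitely supported vectors, and such a
  kernel is the kernel of exactly one bounded operator (\<open>kernel_operator_exists\<close>,
  \<open>kernel_operator_unique\<close>).

  For complete positivity, the integrand for a matrix \<open>(f\<^sub>i\<^sub>j)\<close> and vectors \<open>x\<^sub>i\<close> is
  \<open>\<Sum>\<^sub>i\<^sub>j f\<^sub>i\<^sub>j(e\<^sup>i\<^sup>\<theta>) P\<^sub>\<theta>(x\<^sub>j, x\<^sub>i)\<close>, the sum of the entrywise products of two positive semidefinite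
  matrices, which is nonnegative (\<open>psd_sum_product_nonneg\<close>). General vectors are limits of
  their finite restrictions.\<close>

section \<open>Riesz representation and adjoints\<close>

text \<open>The representing vector is the minimiser of \<open>\<parallel>x\<parallel>\<^sup>2 - 2 \<phi>(x)\<close>: by the parallelogram law a
  minimising sequence is Cauchy, and the vanishing of the derivative at the minimiser \<open>y\<close> in
  direction \<open>x\<close> says \<open>\<phi>(x) = \<langle>x, y\<rangle>\<close>.\<close>

lemma Riesz_representation:
  fixes \<phi> :: "'a::{real_inner,banach} \<Rightarrow> real"
  assumes "bounded_linear \<phi>"
  shows "\<exists>y. \<forall>x. \<phi> x = inner x y"
proof -
  interpret bounded_linear \<phi> by fact
  define J where "J x = (norm x)\<^sup>2 - 2 * \<phi> x" for x
  obtain K where K: "\<And>x. norm (\<phi> x) \<le> norm x * K" using bounded by blast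
  have low: "- (K\<^sup>2) \<le> J x" for x
  proof -
    have "\<phi> x \<le> norm x * K" using K[of x] by simp
    moreover have "0 \<le> (norm x - K)\<^sup>2" by simp
    ultimately show ?thesis by (simp add: J_def power2_diff)
  qed
  define m where "m = Inf (range J)"
  have bdd: "bdd_below (range J)" using low by (auto intro!: bdd_belowI)
  have m_le: "m \<le> J x" for x unfolding m_def by (rule cInf_lower) (auto intro: bdd)
  have "\<exists>x. J x < m + inverse (Suc n)" for n
    using cInf_lessD[of "range J" "m + inverse (Suc n)"] by (auto simp: m_def)
  then obtain X where X: "\<And>n. J (X n) < m + inverse (Suc n)" by metis
  have par: "(norm (x - y))\<^sup>2 \<le> 2 * (J x - m) + 2 * (J y - m)" for x y
  proof -
    have "J x + J y - 2 * J ((1/2) *\<^sub>R (x + y)) = (norm (x - y))\<^sup>2 / 2"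
      by (simp add: J_def scaleR add power2_norm_eq_inner inner_simps inner_commute field_simps)
    then show ?thesis using m_le[of "(1/2) *\<^sub>R (x + y)"] by simp
  qed
  have "Cauchy X"
  proof (rule CauchyI)
    fix e :: real assume e: "0 < e"
    then obtain N where N: "inverse (real (Suc N)) < e\<^sup>2 / 4"
      using reals_Archimedean[of "e\<^sup>2 / 4"] by auto
    have small: "J (X n) - m < e\<^sup>2 / 4" if "N \<le> n" for n
    proof -
      have "inverse (real (Suc n)) \<le> inverse (real (Suc N))" using that by (simp add: field_simps)
      then show ?thesis using X[of n] N by linarith
    qed
    show "\<exists>M. \<forall>i\<ge>M. \<forall>j\<ge>M. norm (X i - X j) < e"
    proof (intro exI[of _ N] allI impI)
      fix i j assume ij: "N \<le> i" "N \<le> j"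
      have "(norm (X i - X j))\<^sup>2 < e\<^sup>2"
        using par[of "X i" "X j"] small[OF ij(1)] small[OF ij(2)] by argo
      then show "norm (X i - X j) < e" using e by (simp add: power2_less_imp_less)
    qed
  qed
  then obtain y where y: "X \<longlonglongrightarrow> y" by (auto simp: Cauchy_convergent_iff convergent_def)
  have "(\<lambda>n. J (X n)) \<longlonglongrightarrow> J y"
    unfolding J_def by (intro tendsto_intros tendsto y)
  moreover have "(\<lambda>n. m + inverse (real (Suc n))) \<longlonglongrightarrow> m + 0"
    by (intro tendsto_intros LIMSEQ_inverse_real_of_nat)
  ultimately have Jy: "J y \<le> m"
    using X by (intro LIMSEQ_le[of "\<lambda>n. J (X n)" _ "\<lambda>n. m + inverse (real (Suc n))"])
      (auto intro!: exI[of _ 0] less_imp_le)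
  have "\<phi> x = inner x y" for x
  proof (cases "x = 0")
    case False
    define d where "d = inner x y - \<phi> x"
    \<comment> \<open>The step \<open>t\<close> minimises the quadratic polynomial \<open>J (y + t x)\<close>; it would strictly
      decrease \<open>J\<close> unless \<open>d = 0\<close>.\<close>
    define t where "t = - d / (norm x)\<^sup>2"
    have "J (y + t *\<^sub>R x) = J y + t * (t * (norm x)\<^sup>2) + 2 * t * d"
      by (simp add: J_def d_def add scaleR power2_norm_eq_inner inner_simps inner_commute
          algebra_simps)
    also have "t * (norm x)\<^sup>2 = - d" using False by (simp add: t_def)
    finally have "0 \<le> t * d" using m_le[of "y + t *\<^sub>R x"] Jy by (simp add: algebra_simps)
    moreover have "t * d = - (d\<^sup>2 / (norm x)\<^sup>2)" by (simp add: t_def power2_eq_square)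
    moreover have "d \<noteq> 0 \<Longrightarrow> 0 < d\<^sup>2 / (norm x)\<^sup>2" using False by simp
    ultimately have "d = 0" by fastforce
    then show ?thesis by (simp add: d_def)
  qed (simp add: zero)
  then show ?thesis by blast
qed

lemma cinner_minus_left: "cinner (x - y) z = cinner x z - cinner y z"
  using cinner_add_left[of "x - y" y z] by simp

lemma cinner_minus_right: "cinner x (y - z) = cinner x y - cinner x z"
  using cinner_add_right[of x "y - z" z] by simp

lemma cinner_sum_left: "cinner (sum f S) z = (\<Sum>i\<in>S. cinner (f i) z)"
  by (induction S rule: infinite_finite_induct) (auto simp: cinner_add_left)

lemma cinner_sum_right: "cinner z (sum f S) = (\<Sum>i\<in>S. cinner z (f i))"
  by (induction S rule: infinite_finite_induct) (auto simp: cinner_add_right)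

lemma bounded_linear_scaleC: "bounded_linear (\<lambda>x :: 'a::complex_inner. c *\<^sub>C x)"
proof (rule bounded_linear_intro[where K = "cmod c"])
  show "c *\<^sub>C r *\<^sub>R x = r *\<^sub>R c *\<^sub>C x" for r and x :: 'a
    by (simp flip: scaleC_of_real add: scaleC_scaleC mult.commute)
qed (auto simp: scaleC_add_right norm_scaleC)

lemma bounded_bilinear_cinner: "bounded_bilinear (cinner :: 'a::complex_inner \<Rightarrow> 'a \<Rightarrow> complex)"
proof
  show "cinner (r *\<^sub>R x) y = r *\<^sub>R cinner x y" "cinner x (r *\<^sub>R y) = r *\<^sub>R cinner x y"
    for r and x y :: 'a
    using cinner_scaleC_left[of "of_real r" x y] cinner_scaleC_right[of x "of_real r" y]
    by (simp_all add: scaleC_of_real scaleR_conv_of_real)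
qed (auto simp: cinner_add_left cinner_add_right cinner_Cauchy_Schwarz intro!: exI[of _ 1])

lemma cinner_eqI: "(\<And>z. cinner x z = cinner y z) \<Longrightarrow> x = y"
  using cinner_self[of "x - y"] by (simp add: cinner_minus_left)

text \<open>The complex inner product can be recovered from the real one. This transports statements
  proved with the library's real inner product, such as the existence of adjoints.\<close>

lemma cinner_inner: "cinner x y = Complex (inner x y) (inner ((- \<i>) *\<^sub>C x) y)"
  by (simp add: complex_eq_iff inner_eq_Re_cinner cinner_scaleC_left)

lemma bounded_clinear_compose:
  "bounded_clinear f \<Longrightarrow> bounded_clinear g \<Longrightarrow> bounded_clinear (f \<circ> g)"
  unfolding bounded_clinear_def o_def by (auto intro: bounded_linear_compose)

lemma bounded_clinear_id: "bounded_clinear id"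
  by (simp add: bounded_clinear_def id_def)

text \<open>The Riesz representation yields the adjoint for the real inner product; since \<open>S\<close> commutes
  with multiplication by \<open>- \<i>\<close>, the same map is the adjoint for the complex one.\<close>

lemma adjoint_exists:
  fixes S :: "'a::chilbert_space \<Rightarrow> 'a"
  assumes "bounded_clinear S"
  shows "\<exists>S'. bounded_clinear S' \<and> (\<forall>x y. cinner (S x) y = cinner x (S' y))"
proof -
  interpret S: bounded_linear S using assms by (simp add: bounded_clinear_def)
  have SC: "S (c *\<^sub>C x) = c *\<^sub>C S x" for c x using assms by (simp add: bounded_clinear_def)
  have "\<exists>z. \<forall>x. inner (S x) y = inner x z" for y
    by (rule Riesz_representation)
      (rule bounded_linear_compose[OF bounded_linear_inner_left S.bounded_linear_axioms])
  then obtain S' where S': "\<And>x y. inner (S x) y = inner x (S' y)" by metis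
  have adj: "cinner (S x) y = cinner x (S' y)" for x y
    unfolding cinner_inner S' [symmetric] SC ..
  have adj': "cinner (S' y) x = cinner y (S x)" for x y
    by (metis adj cinner_commute)
  obtain K where K: "\<And>x. norm (S x) \<le> norm x * K" using S.bounded by blast
  have scale: "S' (c *\<^sub>C x) = c *\<^sub>C S' x" for c x
    by (rule cinner_eqI) (simp add: adj' cinner_scaleC_left)
  have "bounded_linear S'"
  proof (rule bounded_linear_intro)
    show "S' (x + y) = S' x + S' y" for x y
      by (rule cinner_eqI) (simp add: adj' cinner_add_left)
    show "S' (r *\<^sub>R x) = r *\<^sub>R S' x" for r x
      using scale[of "of_real r" x] by (simp add: scaleC_of_real)
    fix y
    have "norm (S' y) * norm (S' y) = inner (S (S' y)) y"
      by (simp add: S' power2_norm_eq_inner[symmetric] power2_eq_square)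
    also have "\<dots> \<le> norm (S (S' y)) * norm y" by (rule norm_cauchy_schwarz)
    also have "\<dots> \<le> norm (S' y) * K * norm y" by (intro mult_right_mono K) simp
    finally have "norm (S' y) * norm (S' y) \<le> norm (S' y) * (norm y * K)" by (simp add: mult_ac)
    moreover have "0 \<le> norm y * K" using K[of y] norm_ge_zero order_trans by blast
    ultimately show "norm (S' y) \<le> norm y * K"
      by (cases "S' y = 0") (auto simp del: mult_le_cancel_left)
  qed
  then show ?thesis using adj scale by (auto simp: bounded_clinear_def)
qed

text \<open>Existence and uniqueness make the definite description that defines \<^const>\<open>cadjoint\<close>
  meaningful.\<close>

lemma cinner_cadjoint:
  fixes S :: "'a::chilbert_space \<Rightarrow> 'a"
  assumes "bounded_clinear S"
  shows "bounded_clinear (cadjoint S)" "cinner (cadjoint S x) y = cinner x (S y)"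
proof -
  let ?P = "\<lambda>S'. bounded_clinear S' \<and> (\<forall>x y. cinner (S x) y = cinner x (S' y))"
  have "\<exists>!S'. ?P S'"
  proof (rule ex_ex1I[OF adjoint_exists[OF assms]])
    fix S' S'' assume "?P S'" "?P S''"
    then show "S' = S''" by (metis cinner_commute cinner_eqI ext)
  qed
  then have P: "?P (cadjoint S)" unfolding cadjoint_def by (rule theI')
  then show "bounded_clinear (cadjoint S)" by blast
  show "cinner (cadjoint S x) y = cinner x (S y)" using P by (metis cinner_commute)
qed

lemma bounded_clinear_word_op:
  "(\<And>k. bounded_clinear (A k)) \<Longrightarrow> bounded_clinear (word_op A w)"
  by (induction w) (auto simp: bounded_clinear_id bounded_clinear_compose)

text \<open>The left-hand side is \<open>\<langle>S h, h\<rangle>\<close> for \<open>S = \<Sum>\<^sub>k A\<^sub>k\<^sup>* A\<^sub>k\<close>. This is the form in which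
  the norm hypothesis enters.\<close>

lemma column_contraction:
  fixes A :: "'q::finite \<Rightarrow> 'h::chilbert_space \<Rightarrow> 'h"
  assumes A: "\<And>k. bounded_clinear (A k)"
    and le1: "onorm (\<lambda>h. \<Sum>k\<in>UNIV. cadjoint (A k) (A k h)) \<le> 1"
  shows "(\<Sum>k\<in>UNIV. (norm (A k h))\<^sup>2) \<le> (norm h)\<^sup>2"
proof -
  let ?S = "\<lambda>h. \<Sum>k\<in>UNIV. cadjoint (A k) (A k h)"
  have bl: "bounded_linear (A k)" "bounded_linear (cadjoint (A k))" for k
    using A cinner_cadjoint(1)[OF A] by (auto simp: bounded_clinear_def)
  have "bounded_linear ?S"
    by (intro bounded_linear_sum bounded_linear_compose[OF bl(2) bl(1)])
  then have "norm (?S h) \<le> onorm ?S * norm h" by (rule onorm)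
  also have "\<dots> \<le> 1 * norm h" by (intro mult_right_mono le1) simp
  finally have S: "norm (?S h) \<le> norm h" by simp
  have "complex_of_real (\<Sum>k\<in>UNIV. (norm (A k h))\<^sup>2) = cinner (?S h) h"
    by (simp add: cinner_sum_left cinner_cadjoint(2)[OF A] cinner_self)
  then have "(\<Sum>k\<in>UNIV. (norm (A k h))\<^sup>2) = inner (?S h) h"
    by (metis Re_complex_of_real inner_eq_Re_cinner)
  also have "\<dots> \<le> norm (?S h) * norm h" by (rule norm_cauchy_schwarz)
  also have "\<dots> \<le> norm h * norm h" by (intro mult_right_mono S) simp
  finally show ?thesis by (simp add: power2_eq_square)
qed

section \<open>Bounded operators from kernels\<close>

lemma summable_on_Cauchy:
  fixes f :: "'i \<Rightarrow> 'a::banach"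
  assumes small: "\<And>e. 0 < e \<Longrightarrow>
    \<exists>F\<^sub>0. finite F\<^sub>0 \<and> (\<forall>F. finite F \<longrightarrow> F \<inter> F\<^sub>0 = {} \<longrightarrow> norm (sum f F) \<le> e)"
  shows "f summable_on UNIV"
proof -
  let ?S = "filtermap (sum f) (finite_subsets_at_top UNIV)"
  have "cauchy_filter ?S"
    unfolding cauchy_filter_metric_filtermap
  proof (intro allI impI)
    fix e :: real assume e: "0 < e"
    then obtain F\<^sub>0 where F\<^sub>0: "finite F\<^sub>0"
      and le: "\<And>F. finite F \<Longrightarrow> F \<inter> F\<^sub>0 = {} \<Longrightarrow> norm (sum f F) \<le> e / 3"
      using small[of "e / 3"] by auto
    have "dist (sum f F) (sum f G) < e"
      if "finite F" "F\<^sub>0 \<subseteq> F" "finite G" "F\<^sub>0 \<subseteq> G" for F G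
    proof -
      have "sum f F - sum f G = sum f (F - G) - sum f (G - F)"
        using that sum.Int_Diff[of F f G] sum.Int_Diff[of G f F] by (simp add: Int_commute)
      also have "norm \<dots> \<le> norm (sum f (F - G)) + norm (sum f (G - F))"
        by (rule norm_triangle_ineq4)
      also have "\<dots> \<le> e / 3 + e / 3"
        using that by (intro add_mono le) auto
      finally show ?thesis using e by (simp add: dist_norm)
    qed
    then show "\<exists>P. eventually P (finite_subsets_at_top UNIV)
        \<and> (\<forall>F G. P F \<and> P G \<longrightarrow> dist (sum f F) (sum f G) < e)"
      by (intro exI[of _ "\<lambda>F. finite F \<and> F\<^sub>0 \<subseteq> F"])
        (auto simp: eventually_finite_subsets_at_top F\<^sub>0 intro!: exI[of _ F\<^sub>0])
  qed
  then obtain x where "?S \<le> nhds x"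
    using cauchy_filter_complete_converges[of ?S UNIV] complete_UNIV
    by (auto simp: filtermap_bot_iff)
  then have "(sum f \<longlongrightarrow> x) (finite_subsets_at_top UNIV)"
    by (auto simp: filterlim_def)
  then show ?thesis by (auto simp: summable_on_def has_sum_def)
qed

definition ell2_restrict :: "'i set \<Rightarrow> ('i, 'h::complex_inner) ell2 \<Rightarrow> ('i, 'h) ell2" where
  "ell2_restrict F x = (\<Sum>v\<in>F. delta v \<otimes>\<^sub>h coord x v)"

lemma coord_restrict:
  "finite F \<Longrightarrow> coord (ell2_restrict F x) i = (if i \<in> F then coord x i else 0)"
  by (simp add: ell2_restrict_def coord_sum coord_delta_tensor)

text \<open>By Pythagoras, the squared distance from \<open>x\<close> to its restriction is the tail of the series for
  \<open>\<parallel>x\<parallel>\<^sup>2\<close>.\<close>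

lemma tendsto_restrict:
  "((\<lambda>F. ell2_restrict F x) \<longlongrightarrow> x) (finite_subsets_at_top UNIV)"
proof -
  have eq: "(norm x)\<^sup>2 - (\<Sum>i\<in>F. (norm (coord x i))\<^sup>2) = (norm (ell2_restrict F x - x))\<^sup>2"
    if F: "finite F" for F
  proof -
    have "(\<lambda>i. if i \<in> F then (norm (coord x i))\<^sup>2 else 0) summable_on UNIV"
      by (rule finite_nonzero_values_imp_summable_on) (rule finite_subset[OF _ F], auto)
    moreover have "(\<Sum>\<^sub>\<infinity>i. if i \<in> F then (norm (coord x i))\<^sup>2 else 0)
        = (\<Sum>\<^sub>\<infinity>i\<in>F. (norm (coord x i))\<^sup>2)"
      by (rule infsum_cong_neutral) auto
    moreover have "(norm x)\<^sup>2 = (\<Sum>\<^sub>\<infinity>i. (norm (coord (ell2_restrict F x - x) i))\<^sup>2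
        + (if i \<in> F then (norm (coord x i))\<^sup>2 else 0))"
      unfolding norm_ell2_sq by (rule infsum_cong) (simp add: coord_minus coord_restrict F)
    ultimately show ?thesis
      using F by (simp add: infsum_add coord_summable norm_ell2_sq)
  qed
  have "((\<lambda>F. (norm x)\<^sup>2 - (\<Sum>i\<in>F. (norm (coord x i))\<^sup>2)) \<longlongrightarrow> (norm x)\<^sup>2 - (norm x)\<^sup>2)
      (finite_subsets_at_top UNIV)"
    unfolding norm_ell2_sq by (intro tendsto_intros infsum_tendsto coord_summable)
  moreover have "\<forall>\<^sub>F F in finite_subsets_at_top UNIV.
      (norm x)\<^sup>2 - (\<Sum>i\<in>F. (norm (coord x i))\<^sup>2) = (norm (ell2_restrict F x - x))\<^sup>2"
    by (rule eventually_finite_subsets_at_top_weakI) (rule eq)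
  ultimately have "((\<lambda>F. (norm (ell2_restrict F x - x))\<^sup>2) \<longlongrightarrow> 0) (finite_subsets_at_top UNIV)"
    by (simp add: tendsto_cong)
  from tendsto_real_sqrt[OF this]
  have "((\<lambda>F. norm (ell2_restrict F x - x)) \<longlongrightarrow> 0) (finite_subsets_at_top UNIV)" by simp
  then show ?thesis by (rule LIM_zero_cancel[OF tendsto_norm_zero_cancel])
qed

lemma cinner_delta_tensor: "cinner x (delta u \<otimes>\<^sub>h h) = cinner (coord x u) h"
proof -
  have "cinner x (delta u \<otimes>\<^sub>h h) = (\<Sum>\<^sub>\<infinity>i\<in>{u}. cinner (coord x i) h)"
    unfolding cinner_ell2_def by (rule infsum_cong_neutral) (auto simp: coord_delta_tensor)
  then show ?thesis by simp
qed

lemma kernel_operator_restrict: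
  assumes T: "kernel_operator K T"
  shows "coord (T (ell2_restrict F x)) u = (\<Sum>v\<in>F. K u v (coord x v))"
proof -
  interpret T: bounded_linear T
    using T by (simp add: kernel_operator_def bounded_clinear_def)
  have "coord (T (delta v \<otimes>\<^sub>h h)) u = K u v h" for v h
    by (rule cinner_eqI) (use T in \<open>simp add: kernel_operator_def cinner_delta_tensor[symmetric]\<close>)
  then show ?thesis by (simp add: ell2_restrict_def T.sum coord_sum)
qed

text \<open>The kernel determines the operator on vectors of finite support, which are dense.\<close>

lemma kernel_operator_unique:
  assumes S: "kernel_operator K S" and T: "kernel_operator K T"
  shows "S = T"
proof
  fix x
  have eq: "S (ell2_restrict F x) = T (ell2_restrict F x)" for F
    by (rule ell2_eqI) (simp add: kernel_operator_restrict[OF S] kernel_operator_restrict[OF T])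
  have lim: "((\<lambda>F. R (ell2_restrict F x)) \<longlongrightarrow> R x) (finite_subsets_at_top UNIV)"
    if "kernel_operator K R" for R
    using that by (intro bounded_linear.tendsto[OF _ tendsto_restrict])
      (simp add: kernel_operator_def bounded_clinear_def)
  show "S x = T x"
    using lim[OF S] lim[OF T] unfolding eq by (rule tendsto_unique[rotated]) simp
qed

lemma kernel_operator_form:
  assumes T: "kernel_operator K T"
  shows "cinner (T (ell2_restrict F x)) (ell2_restrict E y)
    = (\<Sum>u\<in>E. \<Sum>v\<in>F. cinner (K u v (coord x v)) (coord y u))"
  by (simp add: ell2_restrict_def[of E] cinner_sum_right cinner_delta_tensor
      kernel_operator_restrict[OF T] cinner_sum_left)

text \<open>Boundedness on vectors of finite support suffices. The bound for a single row shows that the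
  series \<open>\<Sum>\<^sub>v K(u, v) x\<^sub>v\<close> satisfies the Cauchy criterion, although it need not converge absolutely;
  letting the finite sums grow, the bound for finitely many rows then shows that its sums form a
  square-summable family.\<close>

lemma kernel_operator_exists:
  fixes K :: "'i \<Rightarrow> 'i \<Rightarrow> 'h::chilbert_space \<Rightarrow> 'h"
  assumes lin: "\<And>u v. bounded_clinear (K u v)" and C: "0 \<le> C"
    and bound: "\<And>E F x. finite E \<Longrightarrow> finite F \<Longrightarrow>
      (\<Sum>u\<in>E. (norm (\<Sum>v\<in>F. K u v (x v)))\<^sup>2) \<le> C\<^sup>2 * (\<Sum>v\<in>F. (norm (x v))\<^sup>2)"
  shows "\<exists>T. kernel_operator K T \<and> (\<forall>x. norm (T x) \<le> C * norm x)"
proof -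
  define L where "L x u = (\<Sum>\<^sub>\<infinity>v. K u v (coord x v))" for x u
  have summ: "(\<lambda>v. K u v (coord x v)) summable_on UNIV" for x u
  proof (rule summable_on_Cauchy)
    fix e :: real assume e: "0 < e"
    \<comment> \<open>Adding 1 to \<open>C\<close> covers the case \<open>C = 0\<close>.\<close>
    define d where "d = (e / (C + 1))\<^sup>2"
    have d: "0 < d" using e C by (simp add: d_def)
    obtain F\<^sub>0 where F\<^sub>0: "finite F\<^sub>0"
      and dist: "dist (\<Sum>v\<in>F\<^sub>0. (norm (coord x v))\<^sup>2) ((norm x)\<^sup>2) \<le> d"
      using infsum_finite_approximation[OF coord_summable[of x] d] by (auto simp: norm_ell2_sq)
    show "\<exists>F\<^sub>0. finite F\<^sub>0 \<and> (\<forall>F. finite F \<longrightarrow> F \<inter> F\<^sub>0 = {} \<longrightarrow> norm (\<Sum>v\<in>F. K u v (coord x v)) \<le> e)"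
    proof (intro exI[of _ F\<^sub>0] conjI allI impI F\<^sub>0)
      fix F :: "'i set" assume F: "finite F" "F \<inter> F\<^sub>0 = {}"
      have "(\<Sum>v\<in>F. (norm (coord x v))\<^sup>2) + (\<Sum>v\<in>F\<^sub>0. (norm (coord x v))\<^sup>2) \<le> (norm x)\<^sup>2"
        using sum_coord_le[of "F \<union> F\<^sub>0" x] F F\<^sub>0 by (simp add: sum.union_disjoint)
      then have le: "(\<Sum>v\<in>F. (norm (coord x v))\<^sup>2) \<le> d"
        using dist by (simp add: dist_real_def)
      have "(norm (\<Sum>v\<in>F. K u v (coord x v)))\<^sup>2 \<le> C\<^sup>2 * (\<Sum>v\<in>F. (norm (coord x v))\<^sup>2)"
        using bound[of "{u}" F "coord x"] F by simp
      also have "\<dots> \<le> C\<^sup>2 * d" by (intro mult_left_mono le) simp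
      also have "\<dots> \<le> (C + 1)\<^sup>2 * d" using C d by (intro mult_right_mono power_mono) auto
      also have "\<dots> = e\<^sup>2" using C by (simp add: d_def power_divide)
      finally show "norm (\<Sum>v\<in>F. K u v (coord x v)) \<le> e"
        by (rule power2_le_imp_le) (use e in simp)
    qed
  qed
  have fin_le: "(\<Sum>u\<in>E. (norm (L x u))\<^sup>2) \<le> (C * norm x)\<^sup>2" if E: "finite E" for x E
  proof (rule tendsto_upperbound)
    show "((\<lambda>F. \<Sum>u\<in>E. (norm (\<Sum>v\<in>F. K u v (coord x v)))\<^sup>2) \<longlongrightarrow> (\<Sum>u\<in>E. (norm (L x u))\<^sup>2))
        (finite_subsets_at_top UNIV)"
      unfolding L_def by (intro tendsto_intros infsum_tendsto summ)
    show "\<forall>\<^sub>F F in finite_subsets_at_top UNIV.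
        (\<Sum>u\<in>E. (norm (\<Sum>v\<in>F. K u v (coord x v)))\<^sup>2) \<le> (C * norm x)\<^sup>2"
    proof (rule eventually_finite_subsets_at_top_weakI)
      fix F :: "'i set" assume F: "finite F"
      show "(\<Sum>u\<in>E. (norm (\<Sum>v\<in>F. K u v (coord x v)))\<^sup>2) \<le> (C * norm x)\<^sup>2"
        using bound[OF E F, of "coord x"] mult_left_mono[OF sum_coord_le[OF F, of x], of "C\<^sup>2"]
        by (simp add: power_mult_distrib)
    qed
  qed simp
  have L_summ: "(\<lambda>u. (norm (L x u))\<^sup>2) summable_on UNIV" for x
    by (rule nonneg_bounded_partial_sums_imp_summable_on[of _ _ "(C * norm x)\<^sup>2"])
      (use fin_le in \<open>auto intro!: eventually_finite_subsets_at_top_weakI\<close>)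
  then have cL: "coord (Abs_ell2 (L x)) = L x" for x by (simp add: Abs_ell2_inverse)
  define T where "T x = Abs_ell2 (L x)" for x
  have cT: "coord (T x) u = L x u" for x u by (simp add: T_def cL)
  have normT: "norm (T x) \<le> C * norm x" for x
  proof (rule power2_le_imp_le)
    show "(norm (T x))\<^sup>2 \<le> (C * norm x)\<^sup>2"
      unfolding norm_ell2_sq[of "T x"]
      by (rule infsum_le_finite_sums) (auto simp: L_summ cT fin_le)
  qed (simp add: C)
  have K: "K u v (x + y) = K u v x + K u v y" "K u v (c *\<^sub>C x) = c *\<^sub>C K u v x" "K u v 0 = 0"
    for u v c x y
    using lin[of u v] by (auto simp: bounded_clinear_def linear_simps)
  have T_scale: "T (c *\<^sub>C x) = c *\<^sub>C T x" for c x
  proof (rule ell2_eqI)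
    fix u
    have "((\<lambda>v. c *\<^sub>C K u v (coord x v)) has_sum c *\<^sub>C L x u) UNIV"
      unfolding L_def by (intro has_sum_bounded_linear[OF bounded_linear_scaleC] has_sum_infsum summ)
    then show "coord (T (c *\<^sub>C x)) u = coord (c *\<^sub>C T x) u"
      by (simp add: cT scaleC_ell2.rep_eq L_def[of "c *\<^sub>C x"] K infsumI)
  qed
  have "bounded_linear T"
  proof (rule bounded_linear_intro)
    show "T (x + y) = T x + T y" for x y
      by (rule ell2_eqI) (simp add: cT L_def coord_add K infsum_add summ)
    show "T (r *\<^sub>R x) = r *\<^sub>R T x" for r x
      using T_scale[of "of_real r" x] by (simp add: scaleC_of_real)
    show "norm (T x) \<le> norm x * C" for x using normT[of x] by (simp add: mult.commute)
  qed
  moreover have "cinner (T (delta v \<otimes>\<^sub>h h)) (delta u \<otimes>\<^sub>h h') = cinner (K u v h) h'" for u v h h'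
  proof -
    have "L (delta v \<otimes>\<^sub>h h) u = (\<Sum>\<^sub>\<infinity>w\<in>{v}. K u w h)"
      unfolding L_def by (rule infsum_cong_neutral) (auto simp: coord_delta_tensor K)
    then show ?thesis by (simp add: cinner_delta_tensor cT)
  qed
  ultimately show ?thesis using T_scale normT
    by (auto simp: kernel_operator_def bounded_clinear_def)
qed

section \<open>Positive semidefinite matrices\<close>

text \<open>Throughout, a matrix \<open>F\<close> is positive semidefinite if its quadratic form takes values \<open>\<ge> 0\<close> in
  the order on \<^typ>\<open>complex\<close>, which includes that these values are real. Vectors supported on two
  indices give everything that is needed about the entries.\<close>

lemma psd_two_point:
  fixes F :: "nat \<Rightarrow> nat \<Rightarrow> complex"
  assumes psd: "\<And>c. 0 \<le> (\<Sum>i<n. \<Sum>j<n. F i j * c j * cnj (c i))" and ij: "i < n" "j < n"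
  shows "0 \<le> a * cnj a * F i i + b * cnj a * F i j + a * cnj b * F j i + b * cnj b * F j j"
proof -
  define c where "c k = (if k = i then a else 0) + (if k = j then b else 0)" for k
  have row: "(\<Sum>l<n. F k l * c l * cnj (c k)) = (F k i * a + F k j * b) * cnj (c k)" for k
  proof -
    have "(\<Sum>l<n. F k l * c l * cnj (c k))
        = (\<Sum>l<n. (if l = i then F k i * a else 0) + (if l = j then F k j * b else 0)) * cnj (c k)"
      unfolding sum_distrib_right by (rule sum.cong) (auto simp: c_def algebra_simps)
    then show ?thesis using ij by (simp add: sum.distrib)
  qed
  have "(\<Sum>k<n. (F k i * a + F k j * b) * cnj (c k))
      = (\<Sum>k<n. (if k = i then (F i i * a + F i j * b) * cnj a else 0)
              + (if k = j then (F j i * a + F j j * b) * cnj b else 0))"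
    by (rule sum.cong) (auto simp: c_def algebra_simps)
  then show ?thesis using psd[of c] ij unfolding row by (simp add: sum.distrib algebra_simps)
qed

lemma psd_diagonal:
  fixes F :: "nat \<Rightarrow> nat \<Rightarrow> complex"
  assumes psd: "\<And>c. 0 \<le> (\<Sum>i<n. \<Sum>j<n. F i j * c j * cnj (c i))" and i: "i < n"
  shows "0 \<le> F i i"
  using psd_two_point[OF psd i i, of 1 0] by simp

text \<open>The values 1 and \<open>\<i>\<close> of the second coordinate make \<open>F\<^sub>i\<^sub>j + F\<^sub>j\<^sub>i\<close> and \<open>\<i> (F\<^sub>i\<^sub>j - F\<^sub>j\<^sub>i)\<close> real.\<close>

lemma psd_hermitian:
  fixes F :: "nat \<Rightarrow> nat \<Rightarrow> complex"
  assumes psd: "\<And>c. 0 \<le> (\<Sum>i<n. \<Sum>j<n. F i j * c j * cnj (c i))" and ij: "i < n" "j < n"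
  shows "F j i = cnj (F i j)"
proof -
  have "0 \<le> F i i" "0 \<le> F j j" using psd_diagonal[OF psd] ij by auto
  then show ?thesis
    using psd_two_point[OF psd ij, of 1 1] psd_two_point[OF psd ij, of 1 \<i>]
    by (simp add: complex_eq_iff less_eq_complex_def)
qed

text \<open>If \<open>F\<^sub>j\<^sub>j = 0\<close>, the quadratic form at \<open>e\<^sub>i - s F\<^sub>i\<^sub>j\<^sup>* e\<^sub>j\<close> is \<open>F\<^sub>i\<^sub>i - 2 s |F\<^sub>i\<^sub>j|\<^sup>2\<close>, which would become
  negative for large \<open>s\<close>.\<close>

lemma psd_zero_diagonal:
  fixes F :: "nat \<Rightarrow> nat \<Rightarrow> complex"
  assumes psd: "\<And>c. 0 \<le> (\<Sum>i<n. \<Sum>j<n. F i j * c j * cnj (c i))" and ij: "i < n" "j < n"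
    and zero: "F j j = 0"
  shows "F i j = 0"
proof (rule ccontr)
  assume "F i j \<noteq> 0"
  then have m: "0 < (cmod (F i j))\<^sup>2" by simp
  define s where "s = (Re (F i i) + 1) / (2 * (cmod (F i j))\<^sup>2)"
  have "0 \<le> F i i - 2 * of_real s * (F i j * cnj (F i j))"
    using psd_two_point[OF psd ij, of 1 "- of_real s * cnj (F i j)"] psd_hermitian[OF psd ij]
    by (simp add: zero algebra_simps)
  then have "0 \<le> Re (F i i) - 2 * s * (cmod (F i j))\<^sup>2"
    unfolding complex_norm_square[symmetric] by (simp add: less_eq_complex_def)
  also have "2 * s * (cmod (F i j))\<^sup>2 = Re (F i i) + 1" using m by (simp add: s_def)
  finally show False by simp
qed

text \<open>Splitting a positive semidefinite matrix into rank one pieces would reduce the claim to the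
  positivity of \<open>G\<close>. The induction peels off one such piece at a time: subtracting
  \<open>F\<^sub>i\<^sub>n F\<^sub>n\<^sub>j / F\<^sub>n\<^sub>n\<close> clears the last row and column and leaves the Schur complement, which is positive
  semidefinite again. If \<open>F\<^sub>n\<^sub>n = 0\<close>, that row and column vanish already, and the convention
  \<open>z / 0 = 0\<close> lets both cases be treated alike.\<close>

lemma psd_sum_product_nonneg:
  fixes F G :: "nat \<Rightarrow> nat \<Rightarrow> complex"
  assumes "\<And>c. 0 \<le> (\<Sum>i<n. \<Sum>j<n. F i j * c j * cnj (c i))"
    and "\<And>c. 0 \<le> (\<Sum>i<n. \<Sum>j<n. G i j * c j * cnj (c i))"
  shows "0 \<le> (\<Sum>i<n. \<Sum>j<n. F i j * G i j)"
  using assms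
proof (induction n arbitrary: F)
  case (Suc n)
  note psd = Suc.prems(1)
  define p where "p = F n n"
  have p: "0 \<le> p" using psd_diagonal[OF psd, of n] by (simp add: p_def)
  have herm: "F i n = cnj (F n i)" if "i \<le> n" for i
    using psd_hermitian[OF psd, of n i] that by simp
  have col: "F i n * p / p = F i n" and row: "p * F n i / p = F n i" if "i \<le> n" for i
    using psd_zero_diagonal[OF psd, of i n] herm[of i] that by (cases "p = 0"; simp add: p_def)+
  define F' where "F' i j = F i j - F i n * F n j / p" for i j
  have "0 \<le> (\<Sum>i<n. \<Sum>j<n. F' i j * G i j)"
  proof (rule Suc.IH)
    fix c :: "nat \<Rightarrow> complex"
    define S where "S = (\<Sum>j<n. F n j * c j)"
    have S': "(\<Sum>i<n. F i n * cnj (c i)) = cnj S" by (simp add: S_def herm)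
    \<comment> \<open>This last coordinate completes the square, so that the form of \<open>F\<close> at \<open>d\<close> is the form
      of the Schur complement at \<open>c\<close>.\<close>
    define d where "d = c(n := - S / p)"
    have d: "d i = c i" if "i < n" for i using that by (simp add: d_def)
    have pp: "cnj p = p" using p by (simp add: complex_eq_iff less_eq_complex_def)
    have "(\<Sum>i<Suc n. \<Sum>j<Suc n. F i j * d j * cnj (d i))
        = (\<Sum>i<n. \<Sum>j<n. F i j * c j * cnj (c i)) + (\<Sum>i<n. F i n * cnj (c i)) * d n
          + S * cnj (d n) + p * d n * cnj (d n)"
      by (simp add: d sum.distrib sum_distrib_right sum_distrib_left S_def p_def algebra_simps)
    also have "\<dots> = (\<Sum>i<n. \<Sum>j<n. F i j * c j * cnj (c i)) - cnj S * S / p"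
      unfolding S' by (cases "p = 0") (simp_all add: d_def pp field_simps)
    also have "cnj S * S / p = (\<Sum>i<n. F i n * cnj (c i)) * (\<Sum>j<n. F n j * c j) / p"
      unfolding S' S_def[symmetric] ..
    also have "\<dots> = (\<Sum>i<n. \<Sum>j<n. F i n * F n j / p * c j * cnj (c i))"
      unfolding sum_product sum_divide_distrib by (intro sum.cong refl) (simp add: mult_ac)
    also have "(\<Sum>i<n. \<Sum>j<n. F i j * c j * cnj (c i)) - \<dots>
        = (\<Sum>i<n. \<Sum>j<n. F' i j * c j * cnj (c i))"
      by (simp add: F'_def sum_subtractf[symmetric] algebra_simps)
    finally show "0 \<le> (\<Sum>i<n. \<Sum>j<n. F' i j * c j * cnj (c i))" using psd[of d] by simp
  next
    fix c :: "nat \<Rightarrow> complex"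
    show "0 \<le> (\<Sum>i<n. \<Sum>j<n. G i j * c j * cnj (c i))"
      using Suc.prems(2)[of "c(n := 0)"] by simp
  qed
  moreover have "0 \<le> (\<Sum>i<Suc n. \<Sum>j<Suc n. G i j * F n j * cnj (F n i)) / p"
    using Suc.prems(2)[of "F n"] p
    by (auto simp: less_eq_complex_def Re_divide Im_divide intro!: divide_nonneg_nonneg mult_nonneg_nonneg)
  moreover have "(\<Sum>i<Suc n. \<Sum>j<Suc n. G i j * F n j * cnj (F n i)) / p
      = (\<Sum>i<Suc n. \<Sum>j<Suc n. F i n * F n j / p * G i j)"
    unfolding sum_divide_distrib by (intro sum.cong refl) (simp add: herm)
  moreover have "(\<Sum>i<Suc n. \<Sum>j<Suc n. F i j * G i j)
      = (\<Sum>i<n. \<Sum>j<n. F' i j * G i j) + (\<Sum>i<Suc n. \<Sum>j<Suc n. F i n * F n j / p * G i j)"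
  proof -
    have "(\<Sum>i<Suc n. \<Sum>j<Suc n. F i j * G i j) - (\<Sum>i<Suc n. \<Sum>j<Suc n. F i n * F n j / p * G i j)
        = (\<Sum>i<Suc n. \<Sum>j<Suc n. F' i j * G i j)"
      by (simp only: F'_def sum_subtractf[symmetric] left_diff_distrib)
    also have "\<dots> = (\<Sum>i<n. \<Sum>j<n. F' i j * G i j)"
    proof -
      have "F' i n = 0" "F' n i = 0" if "i \<le> n" for i
        using col[OF that] row[OF that] by (simp_all add: F'_def p_def[symmetric])
      then show ?thesis by simp
    qed
    finally show ?thesis by (simp add: algebra_simps)
  qed
  ultimately show ?case by simp
qed simp

section \<open>The Toeplitz kernel of a column contraction\<close>

text \<open>These are the matrix entries of the formal inverse \<open>(1 - T)\<^sup>-\<^sup>1 = \<Sum>\<^sub>n T\<^sup>n\<close>.\<close>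

definition suffix_op :: "('q \<Rightarrow> 'h \<Rightarrow> 'h) \<Rightarrow> 'q list \<Rightarrow> 'q list \<Rightarrow> 'h::chilbert_space \<Rightarrow> 'h" where
  "suffix_op A u v = (if \<exists>w. u = w @ v then word_op A (THE w. u = w @ v) else (\<lambda>_. 0))"

lemma suffix_op_append: "suffix_op A (w @ v) v = word_op A w"
  by (simp add: suffix_op_def)

lemma suffix_op_not_suffix: "(\<And>w. u \<noteq> w @ v) \<Longrightarrow> suffix_op A u v h = 0"
  by (simp add: suffix_op_def)

lemma suffix_op_Nil: "suffix_op A [] v h = (if v = [] then h else 0)"
  by (simp add: suffix_op_def)

text \<open>This is the identity \<open>(1 - T)\<^sup>-\<^sup>1 = T (1 - T)\<^sup>-\<^sup>1 + 1\<close>, read entrywise.\<close>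

lemma suffix_op_Cons:
  assumes A: "A k 0 = 0"
  shows "suffix_op A (k # u) v h = A k (suffix_op A u v h) + (if v = k # u then h else 0)"
proof (cases "\<exists>w. u = w @ v")
  case True
  then obtain w where w: "u = w @ v" by blast
  have "suffix_op A (k # u) v = word_op A (k # w)"
    using suffix_op_append[of A "k # w" v] w by simp
  moreover have "v \<noteq> k # u" using arg_cong[OF w, of length] by auto
  ultimately show ?thesis by (simp add: w suffix_op_append)
next
  case False
  then have 0: "suffix_op A u v h = 0" by (intro suffix_op_not_suffix) auto
  show ?thesis
  proof (cases "v = k # u")
    case True
    then show ?thesis using suffix_op_append[of A "[]" v] 0 by (simp add: A)
  next
    case neq: False
    have "suffix_op A (k # u) v h = 0"
      by (rule suffix_op_not_suffix) (use False neq in \<open>auto simp: Cons_eq_append_conv\<close>)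
    then show ?thesis by (simp add: 0 A neq)
  qed
qed

lemma bounded_clinear_suffix_op:
  "(\<And>k. bounded_clinear (A k)) \<Longrightarrow> bounded_clinear (suffix_op A u v)"
  by (simp add: suffix_op_def bounded_clinear_word_op)
    (simp add: bounded_clinear_def)

text \<open>The kernel with all Fourier coefficients replaced by 1, as a form on the coefficient space. The
  diagonal entry is the identity and is contained in both triangular parts, hence the
  correction.\<close>

definition toeplitz :: "('q \<Rightarrow> 'h \<Rightarrow> 'h) \<Rightarrow> 'q list \<Rightarrow> 'q list \<Rightarrow> 'h::chilbert_space \<Rightarrow> 'h \<Rightarrow> complex" where
  "toeplitz A u v h h' = cinner (suffix_op A u v h) h' + cinner h (suffix_op A v u h')
     - (if u = v then cinner h h' else 0)"

lemma toeplitz_commute: "toeplitz A u v h h' = cnj (toeplitz A v u h' h)"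
  unfolding toeplitz_def
  by (simp add: cinner_commute[symmetric])

text \<open>The Fourier coefficients enter only through a scalar that depends on \<open>|u| - |v|\<close>; the rest of
  the kernel does not depend on \<open>f\<close>.\<close>

lemma Gamma_kernel_toeplitz:
  assumes A: "\<And>k. bounded_clinear (A k)"
  shows "cinner (Gamma_kernel A f u v h) h'
    = fourier_coeff f (int (length u) - int (length v)) * toeplitz A u v h h'"
proof -
  consider "u = v" | w where "u = w @ v" "w \<noteq> []" | w where "v = w @ u" "w \<noteq> []"
    | "\<And>w. u \<noteq> w @ v" "\<And>w. v \<noteq> w @ u" by fastforce
  then show ?thesis
  proof cases
    case 1
    have "suffix_op A u u = id" using suffix_op_append[of A "[]" u] by simp
    then show ?thesis using 1 by (simp add: Gamma_kernel_def toeplitz_def cinner_scaleC_left)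
  next
    case (2 w)
    then have "\<And>w. v \<noteq> w @ u" by auto
    then show ?thesis using 2
      by (simp add: Gamma_kernel_def toeplitz_def cinner_scaleC_left suffix_op_append
          suffix_op_not_suffix)
  next
    case (3 w)
    then have "\<And>w. u \<noteq> w @ v" by auto
    then show ?thesis using 3
      by (simp add: Gamma_kernel_def toeplitz_def cinner_scaleC_left suffix_op_append
          suffix_op_not_suffix cinner_cadjoint(2) bounded_clinear_word_op A)
  next
    case 4
    moreover have "u \<noteq> v" using 4(1)[of "[]"] by simp
    ultimately show ?thesis
      by (simp add: Gamma_kernel_def toeplitz_def suffix_op_not_suffix)
  qed
qed

lemma bounded_clinear_Gamma_kernel:
  assumes A: "\<And>k. bounded_clinear (A k)"
  shows "bounded_clinear (Gamma_kernel A f u v)"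
proof -
  have scale: "bounded_clinear (\<lambda>h. c *\<^sub>C S h)" if "bounded_clinear S" for c S
    using that by (auto simp: bounded_clinear_def scaleC_scaleC mult.commute
        intro: bounded_linear_compose[OF bounded_linear_scaleC])
  have zero: "bounded_clinear (\<lambda>h. 0 :: 'b)" by (simp add: bounded_clinear_def)
  show ?thesis
    by (simp add: Gamma_kernel_def Let_def zero scale bounded_clinear_word_op[OF A]
        cinner_cadjoint(1)[OF bounded_clinear_word_op[OF A]])
qed

definition words :: "nat \<Rightarrow> 'q list set" where
  "words N = {u. length u \<le> N}"

lemma finite_words: "finite (words N :: 'q::finite list set)"
  using finite_lists_length_le[of "UNIV :: 'q set" N] by (simp add: words_def)

lemma finite_subset_words:
  assumes "finite F" obtains N where "F \<subseteq> words N"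
proof
  show "F \<subseteq> words (Max (length ` F))" using assms by (auto simp: words_def)
qed

lemma filterlim_words:
  "filterlim (words :: nat \<Rightarrow> 'q::finite list set) (finite_subsets_at_top UNIV) sequentially"
  unfolding filterlim_finite_subsets_at_top
proof (intro allI impI)
  fix X :: "'q list set" assume "finite X \<and> X \<subseteq> UNIV"
  then obtain N where "X \<subseteq> words N" using finite_subset_words by blast
  then show "\<forall>\<^sub>F n in sequentially. finite (words n :: 'q list set) \<and> X \<subseteq> words n \<and> words n \<subseteq> UNIV"
    unfolding eventually_sequentially
    by (intro exI[of _ N]) (use finite_words in \<open>auto simp: words_def\<close>)
qed

text \<open>With \<open>y = (1 - T)\<^sup>-\<^sup>1 x\<close> and \<open>z = T y\<close>, so that \<open>x = y - z\<close>, the form equals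
  \<open>2 Re \<langle>y, x\<rangle> - \<parallel>x\<parallel>\<^sup>2 = \<parallel>y\<parallel>\<^sup>2 - \<parallel>z\<parallel>\<^sup>2\<close>. All of this happens inside the words of length at most \<open>N\<close>,
  where \<open>z\<close> is built from the components of \<open>y\<close> at words of length less than \<open>N\<close>; the column
  contraction therefore gives \<open>\<parallel>z\<parallel> \<le> \<parallel>y\<parallel>\<close> for the truncated norms.\<close>

lemma toeplitz_nonneg:
  fixes A :: "'q::finite \<Rightarrow> 'h::chilbert_space \<Rightarrow> 'h"
  assumes A: "\<And>k. bounded_clinear (A k)"
    and contr: "\<And>h. (\<Sum>k\<in>UNIV. (norm (A k h))\<^sup>2) \<le> (norm h)\<^sup>2"
  shows "0 \<le> (\<Sum>u\<in>words N. \<Sum>v\<in>words N. toeplitz A u v (x v) (x u))"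
proof -
  have bl: "bounded_linear (A k)" for k using A by (simp add: bounded_clinear_def)
  note A0 = linear_simps(3)[OF bl]
  define y where "y u = (\<Sum>v\<in>words N. suffix_op A u v (x v))" for u
  define z where "z u = (case u of [] \<Rightarrow> 0 | k # u' \<Rightarrow> A k (y u'))" for u
  have x: "x u = y u - z u" if "u \<in> words N" for u
  proof (cases u)
    case Nil
    then show ?thesis using that by (simp add: y_def z_def suffix_op_Nil finite_words)
  next
    case (Cons k u')
    then show ?thesis using that
      by (simp add: y_def z_def suffix_op_Cons[of A, OF A0] finite_words sum.distrib
          linear_sum[OF bounded_linear.linear[OF bl]])
  qed
  have "(\<Sum>u\<in>words N. \<Sum>v\<in>words N. toeplitz A u v (x v) (x u))
      = (\<Sum>u\<in>words N. cinner (y u) (x u)) + (\<Sum>u\<in>words N. \<Sum>v\<in>words N. cinner (x v) (suffix_op A v u (x u)))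
        - (\<Sum>u\<in>words N. cinner (x u) (x u))"
    by (simp add: toeplitz_def sum.distrib sum_subtractf y_def cinner_sum_left finite_words)
  also have "(\<Sum>u\<in>words N. \<Sum>v\<in>words N. cinner (x v) (suffix_op A v u (x u)))
      = (\<Sum>v\<in>words N. cinner (x v) (y v))"
    by (subst sum.swap) (simp add: y_def cinner_sum_right)
  also have "(\<Sum>u\<in>words N. cinner (y u) (x u)) + \<dots> - (\<Sum>u\<in>words N. cinner (x u) (x u))
      = (\<Sum>u\<in>words N. cinner (y u) (y u) - cinner (z u) (z u))"
    unfolding sum.distrib[symmetric] sum_subtractf[symmetric]
    by (rule sum.cong) (auto simp: x cinner_minus_left cinner_minus_right)
  also have "\<dots> = of_real ((\<Sum>u\<in>words N. (norm (y u))\<^sup>2) - (\<Sum>u\<in>words N. (norm (z u))\<^sup>2))"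
    by (simp add: cinner_self sum_subtractf)
  finally have eq: "(\<Sum>u\<in>words N. \<Sum>v\<in>words N. toeplitz A u v (x v) (x u)) = \<dots>" .
  have "(\<Sum>u\<in>words N. (norm (z u))\<^sup>2)
      = (\<Sum>u\<in>insert [] ((\<lambda>(u, k). k # u) ` ({u. length u < N} \<times> UNIV)). (norm (z u))\<^sup>2)"
  proof (rule sum.cong[OF _ refl], intro equalityI subsetI)
    fix u :: "'q list" assume "u \<in> words N"
    then show "u \<in> insert [] ((\<lambda>(u, k). k # u) ` ({u. length u < N} \<times> UNIV))"
      by (cases u) (auto simp: words_def)
  qed (auto simp: words_def)
  also have "\<dots> = (\<Sum>(u, k)\<in>{u. length u < N} \<times> UNIV. (norm (A k (y u)))\<^sup>2)"
  proof -
    have fin: "finite {u :: 'q list. length u < N}"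
      by (rule finite_subset[OF _ finite_words[of N]]) (auto simp: words_def)
    have inj: "inj_on (\<lambda>(u, k). k # u) ({u :: 'q list. length u < N} \<times> UNIV)"
      by (auto simp: inj_on_def)
    have "(\<Sum>u\<in>insert [] ((\<lambda>(u, k). k # u) ` ({u. length u < N} \<times> UNIV)). (norm (z u))\<^sup>2)
        = (\<Sum>u\<in>(\<lambda>(u, k). k # u) ` ({u. length u < N} \<times> UNIV). (norm (z u))\<^sup>2)"
      using fin by (subst sum.insert) (auto simp: z_def)
    also have "\<dots> = (\<Sum>(u, k)\<in>{u. length u < N} \<times> UNIV. (norm (A k (y u)))\<^sup>2)"
      by (subst sum.reindex[OF inj]) (simp add: z_def case_prod_beta)
    finally show ?thesis .
  qed
  also have "\<dots> = (\<Sum>u | length u < N. \<Sum>k\<in>UNIV. (norm (A k (y u)))\<^sup>2)"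
    by (simp add: sum.cartesian_product)
  also have "\<dots> \<le> (\<Sum>u | length u < N. (norm (y u))\<^sup>2)"
    by (rule sum_mono) (rule contr)
  also have "\<dots> \<le> (\<Sum>u\<in>words N. (norm (y u))\<^sup>2)"
    by (rule sum_mono2) (auto simp: finite_words, auto simp: words_def)
  finally show ?thesis unfolding eq by (simp add: less_eq_complex_def)
qed

lemma toeplitz_linear:
  assumes A: "\<And>k. bounded_clinear (A k)"
  shows "toeplitz A u v (h + g) h' = toeplitz A u v h h' + toeplitz A u v g h'"
    "toeplitz A u v (c *\<^sub>C h) h' = c * toeplitz A u v h h'"
    "toeplitz A u v h (c *\<^sub>C h') = cnj c * toeplitz A u v h h'"
    "toeplitz A u v 0 h' = 0"
proof -
  have bl: "bounded_linear (suffix_op A u v)" for u v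
    using bounded_clinear_suffix_op[of A, OF A] by (simp add: bounded_clinear_def)
  have sc: "suffix_op A u v (c *\<^sub>C h) = c *\<^sub>C suffix_op A u v h" for u v c h
    using bounded_clinear_suffix_op[of A u v, OF A] by (simp add: bounded_clinear_def)
  show "toeplitz A u v (h + g) h' = toeplitz A u v h h' + toeplitz A u v g h'"
    by (simp add: toeplitz_def linear_simps(1)[OF bl] cinner_add_left)
  show "toeplitz A u v (c *\<^sub>C h) h' = c * toeplitz A u v h h'"
    by (simp add: toeplitz_def sc cinner_scaleC_left algebra_simps)
  show "toeplitz A u v h (c *\<^sub>C h') = cnj c * toeplitz A u v h h'"
    by (simp add: toeplitz_def sc cinner_scaleC_right algebra_simps)
  show "toeplitz A u v 0 h' = 0"
    by (simp add: toeplitz_def linear_simps(3)[OF bl])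
qed

section \<open>Fourier coefficients of bounded functions\<close>

interpretation angle: prob_space angle
  by (rule prob_space_uniform_measure) simp_all

lemma integral_angle:
  fixes f :: "real \<Rightarrow> complex"
  assumes [measurable]: "f \<in> borel_measurable borel"
  shows "(LINT \<theta>|angle. f \<theta>) = (LINT \<theta>|lborel. indicator {0..2 * pi} \<theta> *\<^sub>R f \<theta>) / (2 * pi)"
proof -
  have "angle = density lborel (\<lambda>\<theta>. ennreal (indicator {0..2 * pi} \<theta> / (2 * pi)))"
    unfolding uniform_measure_def
    by (rule arg_cong[of _ _ "density lborel"])
      (auto simp: fun_eq_iff divide_ennreal[symmetric] split: split_indicator)
  then have "(LINT \<theta>|angle. f \<theta>)
      = (LINT \<theta>|lborel. (indicator {0..2 * pi} \<theta> / (2 * pi)) *\<^sub>R f \<theta>)"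
    by (simp add: integral_density)
  also have "\<dots> = (LINT \<theta>|lborel. (indicator {0..2 * pi} \<theta> *\<^sub>R f \<theta>) / complex_of_real (2 * pi))"
    by (rule Bochner_Integration.integral_cong) (auto simp: scaleR_conv_of_real)
  finally show ?thesis by (simp only: integral_divide_zero)
qed

text \<open>Orthogonality of the characters, from the antiderivative \<open>(\<i>/n) e\<^sup>-\<^sup>i\<^sup>n\<^sup>\<theta>\<close>.\<close>

lemma integral_cis:
  "(LINT \<theta>|angle. cis (- (of_int n * \<theta>))) = (if n = 0 then 1 else 0)"
proof (cases "n = 0")
  case True
  then show ?thesis using angle.prob_space by simp
next
  case False
  define F where "F \<theta> = (\<i> / of_int n) * cis (- (of_int n * \<theta>))" for \<theta> :: real
  have "(LINT \<theta>|lborel. indicator {0..2 * pi} \<theta> *\<^sub>R cis (- (of_int n * \<theta>))) = F (2 * pi) - F 0"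
  proof (rule integral_FTC_atLeastAtMost)
    show "continuous_on {0..2 * pi} (\<lambda>\<theta>. cis (- (of_int n * \<theta>)))"
      by (intro continuous_intros)
    show "(F has_vector_derivative cis (- (of_int n * \<theta>))) (at \<theta> within {0..2 * pi})" for \<theta>
      unfolding F_def cis_conv_exp
      by (rule has_vector_derivative_real_field derivative_eq_intros refl | simp add: False mult_ac)+
  qed simp
  also have "cis (- (of_int n * (2 * pi))) = 1"
    using cis_multiple_2pi[of "of_int (- n)"] by (simp add: mult_ac)
  then have "F (2 * pi) - F 0 = 0" by (simp add: F_def)
  finally show ?thesis using False by (subst integral_angle) (simp_all add: borel_measurable_continuous_onI continuous_intros)
qed

lemma measurable_cis: "(\<lambda>\<theta>. cis (r * \<theta>)) \<in> borel_measurable angle"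
proof -
  have "(\<lambda>\<theta>. cis (r * \<theta>)) \<in> borel_measurable borel"
    by (intro borel_measurable_continuous_onI continuous_intros)
  then show ?thesis by (simp add: measurable_def)
qed

lemma measurable_cis_circle: "cis \<in> measurable angle (restrict_space borel (sphere 0 1))"
  using measurable_cis[of 1] by (intro measurable_restrict_space2) auto

text \<open>The real-valued \<^const>\<open>Linf_norm\<close> is a genuine essential bound: the essential supremum is finite
  by definition of \<^const>\<open>Linf\<close>, and nonnegative because the circle has positive measure.\<close>

lemma Linf_bounded:
  assumes f: "f \<in> Linf circle"
  shows Linf_measurable: "(\<lambda>\<theta>. f (cis \<theta>)) \<in> borel_measurable angle"
    and Linf_norm_nonneg: "0 \<le> Linf_norm circle f"
    and Linf_norm_AE: "AE \<theta> in angle. cmod (f (cis \<theta>)) \<le> Linf_norm circle f"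
proof -
  let ?E = "esssup circle (\<lambda>z. ereal (cmod (f z)))"
  have fin: "?E < \<infinity>" and "f \<in> borel_measurable circle" using f by (auto simp: Linf_def)
  then have "f \<in> borel_measurable (restrict_space borel (sphere 0 1))"
    by (simp add: circle_def)
  from measurable_compose[OF measurable_cis_circle this]
  show "(\<lambda>\<theta>. f (cis \<theta>)) \<in> borel_measurable angle" .
  have "AE z in circle. ereal (cmod (f z)) \<le> ?E" by (rule esssup_AE)
  then have ae: "AE \<theta> in angle. ereal (cmod (f (cis \<theta>))) \<le> ?E"
    unfolding circle_def by (rule AE_distrD[OF measurable_cis_circle])
  have "\<exists>\<theta>. ereal (cmod (f (cis \<theta>))) \<le> ?E"
  proof (rule ccontr)
    assume "\<nexists>\<theta>. ereal (cmod (f (cis \<theta>))) \<le> ?E"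
    then have "AE \<theta> in angle. False" using ae by simp
    then show False by simp
  qed
  then have E0: "0 \<le> ?E" by (meson ereal_less_eq(5) norm_ge_zero order_trans)
  then show "0 \<le> Linf_norm circle f" by (simp add: Linf_norm_def real_of_ereal_pos)
  have "?E = ereal (Linf_norm circle f)"
    using fin E0 by (cases ?E) (auto simp: Linf_norm_def)
  then show "AE \<theta> in angle. cmod (f (cis \<theta>)) \<le> Linf_norm circle f" using ae by simp
qed

lemma Linf_one: "(\<lambda>_. 1) \<in> Linf circle"
proof -
  have "esssup circle (\<lambda>z. ereal (cmod 1)) \<le> 1" by (rule esssup_I) auto
  then show ?thesis by (auto simp: Linf_def intro: le_less_trans)
qed

lemma integrable_Linf_cis:
  assumes f: "f \<in> Linf circle"
  shows "integrable angle (\<lambda>\<theta>. f (cis \<theta>) * cis (r * \<theta>))"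
proof (rule angle.integrable_const_bound)
  show "AE \<theta> in angle. norm (f (cis \<theta>) * cis (r * \<theta>)) \<le> Linf_norm circle f"
    using Linf_norm_AE[OF f] by (simp add: norm_mult)
  show "(\<lambda>\<theta>. f (cis \<theta>) * cis (r * \<theta>)) \<in> borel_measurable angle"
    by (intro borel_measurable_times Linf_measurable[OF f] measurable_cis)
qed

lemma integrable_Linf_fourier:
  "f \<in> Linf circle \<Longrightarrow> integrable angle (\<lambda>\<theta>. f (cis \<theta>) * cis (- (of_int n * \<theta>)))"
  using integrable_Linf_cis[of f "- of_int n"] by simp

lemma fourier_coeff_one: "fourier_coeff (\<lambda>_. 1) n = (if n = 0 then 1 else 0)"
  by (simp add: fourier_coeff_def integral_cis)

lemma fourier_coeff_add:
  assumes "f \<in> Linf circle" "g \<in> Linf circle"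
  shows "fourier_coeff (\<lambda>z. f z + g z) n = fourier_coeff f n + fourier_coeff g n"
  using integrable_Linf_fourier[OF assms(1)] integrable_Linf_fourier[OF assms(2)]
  by (simp add: fourier_coeff_def distrib_right)

lemma fourier_coeff_cmult: "fourier_coeff (\<lambda>z. c * f z) n = c * fourier_coeff f n"
  by (simp add: fourier_coeff_def mult.assoc)

lemma fourier_coeff_cong:
  assumes "f \<in> Linf circle" "g \<in> Linf circle" "AE z in circle. f z = g z"
  shows "fourier_coeff f n = fourier_coeff g n"
proof -
  have ae: "AE \<theta> in angle. f (cis \<theta>) = g (cis \<theta>)"
    using assms(3) unfolding circle_def by (rule AE_distrD[OF measurable_cis_circle])
  have m: "(\<lambda>\<theta>. h (cis \<theta>) * cis (- (of_int n * \<theta>))) \<in> borel_measurable angle" if "h \<in> Linf circle" for h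
    using integrable_Linf_fourier[OF that] by auto
  show ?thesis
    unfolding fourier_coeff_def by (rule integral_cong_AE) (use ae m assms in auto)
qed

section \<open>The integral formula and its consequences\<close>

text \<open>The form \<open>P\<^sub>\<theta>\<close>, restricted to the words of length at most \<open>N\<close>; it is the pullback of \<open>P\<close> under a
  unitary that gives \<open>T\<close> the phase \<open>e\<^sup>-\<^sup>i\<^sup>\<theta>\<close>.\<close>

definition toeplitz_form ::
  "('q \<Rightarrow> 'h::chilbert_space \<Rightarrow> 'h) \<Rightarrow> nat \<Rightarrow> real \<Rightarrow> ('q list \<Rightarrow> 'h) \<Rightarrow> ('q list \<Rightarrow> 'h) \<Rightarrow> complex" where
  "toeplitz_form A N \<theta> x y = (\<Sum>u\<in>words N. \<Sum>v\<in>words N.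
     toeplitz A u v (cis (real (length v) * \<theta>) *\<^sub>C x v) (cis (real (length u) * \<theta>) *\<^sub>C y u))"

context
  fixes A :: "'q::finite \<Rightarrow> 'h::chilbert_space \<Rightarrow> 'h"
  assumes A: "\<And>k. bounded_clinear (A k)"
begin

text \<open>As the second argument enters conjugate-linearly, only the difference of the lengths survives in
  the phase, which is then exactly the character that defines the Fourier coefficient of index
  \<open>|u| - |v|\<close>.\<close>

lemma toeplitz_form_expand:
  "toeplitz_form A N \<theta> x y = (\<Sum>u\<in>words N. \<Sum>v\<in>words N.
     cis (- (of_int (int (length u) - int (length v)) * \<theta>)) * toeplitz A u v (x v) (y u))"
proof -
  have "cis a * cnj (cis b) = cis (a - b)" for a b
    by (simp add: cis_cnj cis_mult)
  then show ?thesis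
    unfolding toeplitz_form_def
    by (simp add: toeplitz_linear[OF A] mult.assoc[symmetric] algebra_simps)
qed

lemma toeplitz_form_commute: "toeplitz_form A N \<theta> x y = cnj (toeplitz_form A N \<theta> y x)"
  unfolding toeplitz_form_def cnj_sum toeplitz_commute[symmetric] by (rule sum.swap)

lemma toeplitz_form_linear:
  fixes n :: nat
  shows "toeplitz_form A N \<theta> (\<lambda>v. \<Sum>j<n. c j *\<^sub>C x j v) y = (\<Sum>j<n. c j * toeplitz_form A N \<theta> (x j) y)"
proof (induction n)
  case 0
  show ?case by (simp add: toeplitz_form_def toeplitz_linear[OF A])
next
  case (Suc n)
  then show ?case
    by (simp add: toeplitz_form_expand toeplitz_linear[OF A] distrib_left sum.distrib
        sum_distrib_left mult_ac)
qed

lemma toeplitz_form_sesquilinear: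
  fixes n :: nat
  shows "toeplitz_form A N \<theta> (\<lambda>v. \<Sum>j<n. c j *\<^sub>C x j v) (\<lambda>u. \<Sum>i<n. c i *\<^sub>C x i u)
    = (\<Sum>i<n. \<Sum>j<n. toeplitz_form A N \<theta> (x j) (x i) * c j * cnj (c i))"
proof -
  have right: "toeplitz_form A N \<theta> z (\<lambda>u. \<Sum>i<n. c i *\<^sub>C x i u)
      = (\<Sum>i<n. cnj (c i) * toeplitz_form A N \<theta> z (x i))" for z
    by (subst (1 2) toeplitz_form_commute) (simp add: toeplitz_form_linear)
  show ?thesis
    unfolding toeplitz_form_linear right sum_distrib_left
    by (subst sum.swap) (simp add: mult_ac)
qed

lemma Gamma_form_expand:
  "f (cis \<theta>) * toeplitz_form A N \<theta> x y = (\<Sum>u\<in>words N. \<Sum>v\<in>words N. f (cis \<theta>)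
     * cis (- (of_int (int (length u) - int (length v)) * \<theta>)) * toeplitz A u v (x v) (y u))"
  by (simp only: toeplitz_form_expand sum_distrib_left mult.assoc)

lemma Gamma_form_integrable:
  assumes f: "f \<in> Linf circle"
  shows "integrable angle (\<lambda>\<theta>. f (cis \<theta>) * toeplitz_form A N \<theta> x y)"
  unfolding Gamma_form_expand
  by (intro Bochner_Integration.integrable_sum integrable_mult_left integrable_Linf_fourier[OF f])

lemma Gamma_form_integral:
  assumes f: "f \<in> Linf circle"
  shows "(\<Sum>u\<in>words N. \<Sum>v\<in>words N. cinner (Gamma_kernel A f u v (x v)) (y u))
    = (LINT \<theta>|angle. f (cis \<theta>) * toeplitz_form A N \<theta> x y)"
  unfolding Gamma_form_expand Gamma_kernel_toeplitz[OF A] fourier_coeff_def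
  by (simp add: Bochner_Integration.integral_sum Bochner_Integration.integrable_sum
      integrable_mult_left integrable_Linf_fourier[OF f] del: of_int_diff)

text \<open>Only words of equal length have a nonzero coefficient, and of two such words one is a suffix of
  the other only if they coincide. This gives unitality, and also the mean value of \<open>P\<^sub>\<theta>\<close>.\<close>

lemma Gamma_kernel_one:
  "cinner (Gamma_kernel A (\<lambda>_. 1) u v h) h' = (if u = v then cinner h h' else 0)"
proof (cases "u = v")
  case True
  have "suffix_op A u u = id" using suffix_op_append[of A "[]" u] by simp
  then show ?thesis using True
    by (simp add: Gamma_kernel_toeplitz[OF A] fourier_coeff_one toeplitz_def)
next
  case False
  have "toeplitz A u v h h' = 0" if "length u = length v"
    using that False by (auto simp: toeplitz_def suffix_op_def)
  then show ?thesis using False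
    by (simp add: Gamma_kernel_toeplitz[OF A] fourier_coeff_one)
qed

lemma Gamma_map_eqI: "kernel_operator (Gamma_kernel A f) T \<Longrightarrow> Gamma_map A f = T"
  unfolding Gamma_map_def by (rule the_equality) (auto intro: kernel_operator_unique)

lemma Gamma_map_one: "Gamma_map A (\<lambda>_. 1) = id"
  by (rule Gamma_map_eqI)
    (auto simp: kernel_operator_def bounded_clinear_id Gamma_kernel_one cinner_delta_tensor
      coord_delta_tensor)

context
  assumes contr: "\<And>h. (\<Sum>k\<in>UNIV. (norm (A k h))\<^sup>2) \<le> (norm h)\<^sup>2"
begin

lemma toeplitz_form_nonneg: "0 \<le> toeplitz_form A N \<theta> x x"
  unfolding toeplitz_form_def by (rule toeplitz_nonneg[OF A contr])

text \<open>Positivity of the form at \<open>x + d y\<close>, for the unimodular \<open>d\<close> that makes the cross terms equal to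
  \<open>- |P\<^sub>\<theta>(x, y)|\<close>. This additive form of the Cauchy-Schwarz inequality is linear in the diagonal values
  and can be integrated over \<open>\<theta>\<close> at once.\<close>

lemma toeplitz_form_le:
  "cmod (toeplitz_form A N \<theta> x y)
    \<le> (Re (toeplitz_form A N \<theta> x x) + Re (toeplitz_form A N \<theta> y y)) / 2"
proof -
  let ?B = "toeplitz_form A N \<theta>"
  define d where "d = (if ?B x y = 0 then 1 else - ?B x y / of_real (cmod (?B x y)))"
  have d1: "d * cnj d = 1"
    by (simp add: d_def complex_norm_square[symmetric] power2_eq_square norm_divide)
  have dB: "cnj d * ?B x y = - of_real (cmod (?B x y))"
    using complex_norm_square[of "?B x y"] by (auto simp: d_def power2_eq_square field_simps)
  \<comment> \<open>\<open>x + d y\<close>, written as a linear combination indexed by \<open>{..<2}\<close>.\<close>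
  define z where "z j = (if j = 0 then x else y)" for j :: nat
  define c where "c j = (if j = 0 then 1 else d)" for j :: nat
  have "0 \<le> (\<Sum>i<2. \<Sum>j<2. ?B (z j) (z i) * c j * cnj (c i))"
    using toeplitz_form_nonneg[of N \<theta> "\<lambda>v. \<Sum>j<2. c j *\<^sub>C z j v"]
    by (simp only: toeplitz_form_sesquilinear)
  also have "\<dots> = ?B x x + ?B y y + (cnj d * ?B x y + cnj (cnj d * ?B x y))"
    using toeplitz_form_commute[of N \<theta> y x] d1
    by (simp add: numeral_2_eq_2 z_def c_def algebra_simps)
  finally show ?thesis
    unfolding dB by (simp add: less_eq_complex_def)
qed

lemma toeplitz_form_mean:
  "integrable angle (\<lambda>\<theta>. Re (toeplitz_form A N \<theta> x x))"
  "(LINT \<theta>|angle. Re (toeplitz_form A N \<theta> x x)) = (\<Sum>u\<in>words N. (norm (x u))\<^sup>2)"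
proof -
  have int: "integrable angle (\<lambda>\<theta>. toeplitz_form A N \<theta> x x)"
    using Gamma_form_integrable[OF Linf_one, where N = N and x = x and y = x] by simp
  then show "integrable angle (\<lambda>\<theta>. Re (toeplitz_form A N \<theta> x x))" by simp
  have "(LINT \<theta>|angle. toeplitz_form A N \<theta> x x) = (\<Sum>u\<in>words N. cinner (x u) (x u))"
    using Gamma_form_integral[OF Linf_one, where N = N and x = x and y = x]
    by (simp add: Gamma_kernel_one finite_words)
  then show "(LINT \<theta>|angle. Re (toeplitz_form A N \<theta> x x)) = (\<Sum>u\<in>words N. (norm (x u))\<^sup>2)"
    using int by (simp add: cinner_self)
qed

lemma Gamma_form_le:
  assumes f: "f \<in> Linf circle"
  shows "cmod (\<Sum>u\<in>words N. \<Sum>v\<in>words N. cinner (Gamma_kernel A f u v (x v)) (y u))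
    \<le> Linf_norm circle f * ((\<Sum>u\<in>words N. (norm (x u))\<^sup>2) + (\<Sum>u\<in>words N. (norm (y u))\<^sup>2)) / 2"
proof -
  let ?B = "toeplitz_form A N" and ?M = "Linf_norm circle f"
  have "cmod (LINT \<theta>|angle. f (cis \<theta>) * ?B \<theta> x y) \<le> (LINT \<theta>|angle. cmod (f (cis \<theta>) * ?B \<theta> x y))"
    by (rule integral_norm_bound)
  also have "\<dots> \<le> (LINT \<theta>|angle. ?M * ((Re (?B \<theta> x x) + Re (?B \<theta> y y)) / 2))"
  proof (rule integral_mono_AE)
    show "integrable angle (\<lambda>\<theta>. cmod (f (cis \<theta>) * ?B \<theta> x y))"
      by (intro integrable_norm Gamma_form_integrable f)
    show "integrable angle (\<lambda>\<theta>. ?M * ((Re (?B \<theta> x x) + Re (?B \<theta> y y)) / 2))"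
      by (intro integrable_mult_right integrable_divide Bochner_Integration.integrable_add
          toeplitz_form_mean)
    show "AE \<theta> in angle. cmod (f (cis \<theta>) * ?B \<theta> x y) \<le> ?M * ((Re (?B \<theta> x x) + Re (?B \<theta> y y)) / 2)"
      using Linf_norm_AE[OF f]
    proof eventually_elim
      case (elim \<theta>)
      then show ?case unfolding norm_mult
        by (intro mult_mono toeplitz_form_le) (auto simp: Linf_norm_nonneg[OF f])
    qed
  qed
  also have "\<dots> = ?M * ((\<Sum>u\<in>words N. (norm (x u))\<^sup>2) + (\<Sum>u\<in>words N. (norm (y u))\<^sup>2)) / 2"
    by (simp add: toeplitz_form_mean)
  finally show ?thesis by (simp add: Gamma_form_integral[OF f])
qed

text \<open>The additive bound becomes the multiplicative one by homogeneity: it is applied to \<open>x\<close> and to a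
  multiple \<open>s\<close> of the image of \<open>x\<close>, with \<open>s\<close> chosen afterwards.\<close>

lemma Gamma_operator_exists:
  assumes f: "f \<in> Linf circle"
  shows "\<exists>T. kernel_operator (Gamma_kernel A f) T \<and> (\<forall>x. norm (T x) \<le> Linf_norm circle f * norm x)"
proof (rule kernel_operator_exists)
  let ?M = "Linf_norm circle f" and ?K = "Gamma_kernel A f"
  show "bounded_clinear (?K u v)" for u v by (rule bounded_clinear_Gamma_kernel[OF A])
  show M: "0 \<le> ?M" by (rule Linf_norm_nonneg[OF f])
  fix E F :: "'q list set" and x :: "'q list \<Rightarrow> 'h"
  assume fin: "finite E" "finite F"
  obtain N where N: "E \<union> F \<subseteq> words N" using fin finite_subset_words[of "E \<union> F"] by auto
  define k where "k u = (\<Sum>v\<in>F. ?K u v (x v))" for u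
  define S where "S = (\<Sum>u\<in>E. (norm (k u))\<^sup>2)"
  define X where "X = (\<Sum>v\<in>F. (norm (x v))\<^sup>2)"
  have le: "s * S \<le> ?M * (X + s\<^sup>2 * S) / 2" for s
  proof -
    define x' where "x' v = (if v \<in> F then x v else 0)" for v
    define y where "y u = (if u \<in> E then s *\<^sub>R k u else 0)" for u
    have K0: "?K u v 0 = 0" for u v
      using bounded_clinear_Gamma_kernel[of A f u v, OF A]
      by (simp add: bounded_clinear_def linear_simps)
    have "(\<Sum>v\<in>words N. ?K u v (x' v)) = k u" for u
      unfolding k_def by (rule sum.mono_neutral_cong_right)
        (use N in \<open>auto simp: finite_words x'_def K0\<close>)
    then have "(\<Sum>u\<in>words N. \<Sum>v\<in>words N. cinner (?K u v (x' v)) (y u))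
        = (\<Sum>u\<in>words N. cinner (k u) (y u))"
      by (simp add: cinner_sum_left[symmetric])
    also have "\<dots> = (\<Sum>u\<in>E. cinner (k u) (s *\<^sub>R k u))"
      by (rule sum.mono_neutral_cong_right) (use N in \<open>auto simp: finite_words y_def\<close>)
    also have "\<dots> = of_real (s * S)"
      by (simp add: S_def scaleC_of_real[symmetric] cinner_scaleC_right cinner_self sum_distrib_left)
    finally have "s * S \<le> cmod (\<Sum>u\<in>words N. \<Sum>v\<in>words N. cinner (?K u v (x' v)) (y u))"
      by (metis abs_ge_self norm_of_real)
    also have "\<dots> \<le> ?M * ((\<Sum>u\<in>words N. (norm (x' u))\<^sup>2) + (\<Sum>u\<in>words N. (norm (y u))\<^sup>2)) / 2"
      by (rule Gamma_form_le[OF f])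
    also have "(\<Sum>u\<in>words N. (norm (x' u))\<^sup>2) = X"
      unfolding X_def by (rule sum.mono_neutral_cong_right)
        (use N in \<open>auto simp: finite_words x'_def\<close>)
    also have "(\<Sum>u\<in>words N. (norm (y u))\<^sup>2) = (\<Sum>u\<in>E. s\<^sup>2 * (norm (k u))\<^sup>2)"
      by (rule sum.mono_neutral_cong_right)
        (use N in \<open>auto simp: finite_words y_def power_mult_distrib\<close>)
    also have "\<dots> = s\<^sup>2 * S" by (simp add: S_def sum_distrib_left)
    finally show ?thesis .
  qed
  have "S \<le> ?M\<^sup>2 * X"
  proof (cases "?M = 0")
    case True
    then show ?thesis using le[of 1] by simp
  next
    case False
    then have "0 < ?M" using M by simp
    \<comment> \<open>\<open>s = 1 / M\<close> is optimal: the bound reads \<open>S / M \<le> M X / 2 + S / (2 M)\<close>.\<close>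
    then show ?thesis using le[of "1 / ?M"] by (simp add: field_simps power2_eq_square)
  qed
  then show "(\<Sum>u\<in>E. (norm (\<Sum>v\<in>F. ?K u v (x v)))\<^sup>2) \<le> ?M\<^sup>2 * (\<Sum>v\<in>F. (norm (x v))\<^sup>2)"
    by (simp add: S_def X_def k_def)
qed

lemma Gamma_map_kernel_operator:
  "f \<in> Linf circle \<Longrightarrow> kernel_operator (Gamma_kernel A f) (Gamma_map A f)"
  using Gamma_operator_exists Gamma_map_eqI by metis

lemma Gamma_map_norm_le:
  "f \<in> Linf circle \<Longrightarrow> norm (Gamma_map A f x) \<le> Linf_norm circle f * norm x"
  using Gamma_operator_exists Gamma_map_eqI by metis

text \<open>Each algebraic identity holds for the kernels because Fourier coefficients are linear; it passes
  to the operators because the kernel determines the operator.\<close>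

lemma Linf_operator_map_Gamma: "Linf_operator_map circle (Gamma_map A)"
  unfolding Linf_operator_map_def
proof (intro conjI ballI allI impI)
  fix f g c assume f: "f \<in> Linf circle"
  have ko: "kernel_operator (Gamma_kernel A f) (Gamma_map A f)" if "f \<in> Linf circle" for f
    using that by (rule Gamma_map_kernel_operator)
  show cl: "bounded_clinear (Gamma_map A f)" if "f \<in> Linf circle" for f
    using ko[OF that] by (simp add: kernel_operator_def)
  have sc: "bounded_clinear (\<lambda>x. c *\<^sub>C Gamma_map A f x)"
    using cl[OF f] by (auto simp: bounded_clinear_def scaleC_scaleC mult.commute
        intro: bounded_linear_compose[OF bounded_linear_scaleC])
  show "Gamma_map A (\<lambda>z. c * f z) = (\<lambda>x. c *\<^sub>C Gamma_map A f x)"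
  proof (rule Gamma_map_eqI)
    show "kernel_operator (Gamma_kernel A (\<lambda>z. c * f z)) (\<lambda>x. c *\<^sub>C Gamma_map A f x)"
      using ko[OF f] sc
      by (simp add: kernel_operator_def cinner_scaleC_left Gamma_kernel_toeplitz[OF A]
          fourier_coeff_cmult mult.assoc)
  qed
  assume g: "g \<in> Linf circle"
  show "Gamma_map A f = Gamma_map A g" if ae: "AE z in circle. f z = g z"
  proof -
    have "Gamma_kernel A f = Gamma_kernel A g"
      by (intro ext) (simp add: Gamma_kernel_def fourier_coeff_cong[OF f g ae])
    then show ?thesis by (simp add: Gamma_map_def)
  qed
  have "bounded_clinear (\<lambda>x. Gamma_map A f x + Gamma_map A g x)"
    using cl[OF f] cl[OF g] by (auto simp: bounded_clinear_def scaleC_add_right bounded_linear_add)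
  then show "Gamma_map A (\<lambda>z. f z + g z) = (\<lambda>x. Gamma_map A f x + Gamma_map A g x)"
    using ko[OF f] ko[OF g]
    by (intro Gamma_map_eqI) (simp add: kernel_operator_def cinner_add_left
        Gamma_kernel_toeplitz[OF A] fourier_coeff_add[OF f g] distrib_right)
qed

lemma contractive_Gamma: "contractive circle (Gamma_map A)"
  unfolding contractive_def using Linf_operator_map_Gamma
  by (auto intro!: onorm_bound Gamma_map_norm_le Linf_norm_nonneg)

text \<open>On vectors restricted to \<open>words N\<close> the quadratic form is the integral of sums of entrywise products of the
  two positive semidefinite matrices \<open>F\<^sub>i\<^sub>j(e\<^sup>i\<^sup>\<theta>)\<close> and \<open>P\<^sub>\<theta>(x\<^sub>j, x\<^sub>i)\<close>. Letting \<open>N\<close> grow gives the general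
  case.\<close>

lemma completely_positive_Gamma: "completely_positive circle (Gamma_map A)"
  unfolding completely_positive_def
proof (intro conjI allI impI Linf_operator_map_Gamma)
  fix n F assume "positive_Linf_matrix circle n F"
  then have F: "\<And>i j. i < n \<Longrightarrow> j < n \<Longrightarrow> F i j \<in> Linf circle"
    and psd: "AE z in circle. positive_op_matrix n (\<lambda>i j w. F i j z * w)"
    by (auto simp: positive_Linf_matrix_def)
  have psd': "AE \<theta> in angle. positive_op_matrix n (\<lambda>i j w. F i j (cis \<theta>) * w)"
    using psd unfolding circle_def by (rule AE_distrD[OF measurable_cis_circle])
  show "positive_op_matrix n (\<lambda>i j. Gamma_map A (F i j))"
    unfolding positive_op_matrix_def
  proof
    fix x :: "nat \<Rightarrow> ('q list, 'h) ell2"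
    define r where "r N = (\<lambda>j. ell2_restrict (words N) (x j))" for N
    have approx: "0 \<le> (\<Sum>i<n. \<Sum>j<n. cinner (Gamma_map A (F i j) (r N j)) (r N i))" for N
    proof -
      let ?B = "\<lambda>\<theta> i j. toeplitz_form A N \<theta> (coord (x j)) (coord (x i))"
      let ?h = "\<lambda>\<theta>. \<Sum>i<n. \<Sum>j<n. F i j (cis \<theta>) * ?B \<theta> i j"
      have int: "integrable angle (\<lambda>\<theta>. F i j (cis \<theta>) * ?B \<theta> i j)" if "i < n" "j < n" for i j
        by (rule Gamma_form_integrable[OF F[OF that]])
      then have int_h: "integrable angle ?h" by (intro Bochner_Integration.integrable_sum) auto
      have pos: "AE \<theta> in angle. 0 \<le> ?h \<theta>"
        using psd'
      proof eventually_elim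
        case (elim \<theta>)
        show ?case
        proof (rule psd_sum_product_nonneg)
          fix c :: "nat \<Rightarrow> complex"
          show "0 \<le> (\<Sum>i<n. \<Sum>j<n. F i j (cis \<theta>) * c j * cnj (c i))"
            using elim by (simp add: positive_op_matrix_def cinner_complex_def)
          show "0 \<le> (\<Sum>i<n. \<Sum>j<n. ?B \<theta> i j * c j * cnj (c i))"
            unfolding toeplitz_form_sesquilinear[symmetric] by (rule toeplitz_form_nonneg)
        qed
      qed
      have "(\<Sum>i<n. \<Sum>j<n. cinner (Gamma_map A (F i j) (r N j)) (r N i))
          = (\<Sum>i<n. \<Sum>j<n. LINT \<theta>|angle. F i j (cis \<theta>) * ?B \<theta> i j)"
        unfolding r_def
        by (intro sum.cong refl)
          (simp add: kernel_operator_form[OF Gamma_map_kernel_operator[OF F]] Gamma_form_integral[OF F])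
      also have "\<dots> = (LINT \<theta>|angle. ?h \<theta>)"
        by (subst Bochner_Integration.integral_sum) (use int in \<open>auto intro!: sum.cong\<close>)
      also have "0 \<le> \<dots>"
      proof -
        have "0 \<le> (LINT \<theta>|angle. Re (?h \<theta>))"
          by (rule integral_nonneg_AE) (use pos in \<open>auto simp: less_eq_complex_def\<close>)
        moreover have "(LINT \<theta>|angle. Im (?h \<theta>)) = 0"
          by (rule integral_eq_zero_AE) (use pos in \<open>auto simp: less_eq_complex_def\<close>)
        ultimately show ?thesis
          using int_h by (simp only: less_eq_complex_def integral_Re integral_Im) simp
      qed
      finally show ?thesis .
    qed
    have lim_r: "(\<lambda>N. r N j) \<longlonglongrightarrow> x j" for j
      unfolding r_def by (rule filterlim_compose[OF tendsto_restrict filterlim_words])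
    have lim: "(\<lambda>N. cinner (Gamma_map A (F i j) (r N j)) (r N i)) \<longlonglongrightarrow> cinner (Gamma_map A (F i j) (x j)) (x i)"
      if "i < n" "j < n" for i j
    proof -
      have bl: "bounded_linear (Gamma_map A (F i j))"
        using Gamma_map_kernel_operator[OF F[OF that]]
        by (simp add: kernel_operator_def bounded_clinear_def)
      show ?thesis
        by (rule bounded_bilinear.tendsto[OF bounded_bilinear_cinner
              bounded_linear.tendsto[OF bl lim_r] lim_r])
    qed
    let ?s = "\<lambda>y. \<Sum>i<n. \<Sum>j<n. cinner (Gamma_map A (F i j) (y j)) (y i)"
    have lim_s: "(\<lambda>N. ?s (r N)) \<longlonglongrightarrow> ?s x"
      by (intro tendsto_sum lim) auto
    have "0 \<le> Re (?s x)"
      by (rule LIMSEQ_le_const[OF tendsto_Re[OF lim_s]])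
        (use approx in \<open>auto simp: less_eq_complex_def\<close>)
    moreover have "Im (?s x) = 0"
    proof (rule LIMSEQ_unique[OF tendsto_Im[OF lim_s]])
      have "Im (?s (r N)) = 0" for N
        using approx[of N] by (simp add: less_eq_complex_def)
      then show "(\<lambda>N. Im (?s (r N))) \<longlonglongrightarrow> 0" by simp
    qed
    ultimately show "0 \<le> ?s x" by (simp add: less_eq_complex_def)
  qed
qed

end
end

theorem theorem1p13:
  fixes A :: "'q::finite \<Rightarrow> 'h::chilbert_space \<Rightarrow> 'h"
  assumes "CARD('q) \<ge> 2"
    and "\<And>k. bounded_clinear (A k)"
    and "onorm (\<lambda>h. \<Sum>k\<in>UNIV. cadjoint (A k) (A k h)) \<le> 1"
  shows "(\<forall>f\<in>Linf circle. \<exists>!T. kernel_operator (Gamma_kernel A f) T) \<and>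
         Gamma_map A (\<lambda>_. 1) = id \<and>
         contractive circle (Gamma_map A) \<and>
         completely_positive circle (Gamma_map A)"
proof (intro conjI ballI)
  note A = assms(2)
  have contr: "(\<Sum>k\<in>UNIV. (norm (A k h))\<^sup>2) \<le> (norm h)\<^sup>2" for h
    using A assms(3) by (rule column_contraction)
  show "\<exists>!T. kernel_operator (Gamma_kernel A f) T" if "f \<in> Linf circle" for f
    using Gamma_map_kernel_operator[of A f, OF A contr that]
    by (blast intro: kernel_operator_unique)
  show "Gamma_map A (\<lambda>_. 1) = id" by (rule Gamma_map_one[OF A])
  show "contractive circle (Gamma_map A)" by (rule contractive_Gamma[OF A contr])
  show "completely_positive circle (Gamma_map A)" by (rule completely_positive_Gamma[OF A contr])
qed

end
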